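(* Every rational smooth embedding $f:\mathbb{A}^1_{\mathbb{R}}\dashrightarrow\mathbb{A}^2_{\mathbb{R}}$ whose associated curve $C\subset\mathbb{P}^2_{\mathbb{R}}$ has degree $\leq 3$ is rectifiable.
   Context: We identify $\mathbb{A}^2_{\mathbb{R}}$ with $\mathbb{P}^2_{\mathbb{R}}\setminus L_\infty$, where $L_\infty=\{Z=0\}$, and $\mathbb{A}^1_{\mathbb{R}}$ with the complement of the real point $\{v=0\}$ in $\mathbb{P}^1_{\mathbb{R}}=\mathrm{Proj}(\mathbb{R}[u,v])$. A rational map $X\dashrightarrow Y$ between real algebraic varieties (geometrically integral schemes of finite type over $\mathbb{R}$) with non-empty real loci is $\mathbb{R}$-regular if it is defined at every point of $X(\mathbb{R})$; it is $\mathbb{R}$-biregular if it is birational and both it and its inverse are $\mathbb{R}$-regular. For a rational map $f:\mathbb{A}^1_{\mathbb{R}}\dashrightarrow\mathbb{A}^2_{\mathbb{R}}$, $f_*(\mathbb{A}^1_{\mathbb{R}})$ denotes the scheme-theoretic image of the graph of $f$ under the second projection. A rational smooth embedding $f:\mathbb{A}^1_{\mathbb{R}}\dashrightarrow\mathbb{A}^2_{\mathbb{R}}$ is an $\mathbb{R}$-regular rational map, birational onto its image, such that $f:\mathbb{A}^1_{\mathbb{R}}(\mathbb{R})\to\mathbb{A}^2_{\mathbb{R}}(\mathbb{R})$ is a closed embedding of smooth manifolds whose image equals $(f_*(\mathbb{A}^1_{\mathbb{R}}))(\mathbb{R})$, and such that the curve $f_*(\mathbb{A}^1_{\mathbb{R}})$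 is smooth at each of its real points. Such an $f$ extends uniquely to a morphism $\overline{f}:\mathbb{P}^1_{\mathbb{R}}\to\mathbb{P}^2_{\mathbb{R}}$ birational onto its image; the associated curve of $f$ is $C=\overline{f}(\mathbb{P}^1_{\mathbb{R}})$. $f$ is rectifiable if it is equivalent to the linear embedding $j_{\mathrm{lin}}:t\mapsto(t,0)$, i.e. if there exist $\mathbb{R}$-biregular rational maps $\alpha:\mathbb{A}^1_{\mathbb{R}}\dashrightarrow\mathbb{A}^1_{\mathbb{R}}$ and $\beta:\mathbb{A}^2_{\mathbb{R}}\dashrightarrow\mathbb{A}^2_{\mathbb{R}}$ with $\beta\circ f=j_{\mathrm{lin}}\circ\alpha$. *)

theory Defs
  imports "HOL-Analysis.Analysis" "HOL-Computational_Algebra.Polynomial_Factorial"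
begin

text \<open>
  Polynomial rings in several variables are iterated univariate ones, the innermost variable
  being the first: \<open>real poly poly\<close> is \<open>\<real>[x][y]\<close> and \<open>real poly poly poly\<close> is \<open>\<real>[X][Y][Z]\<close>.
  The evaluation maps take the points in an arbitrary \<open>\<real>\<close>-algebra, whose structure map
  is the parameter \<open>h\<close>. Besides real and complex points this covers points with values in
  function fields, that is, composition of rational maps.
\<close>

definition eval1 :: "(real \<Rightarrow> 'k::comm_ring_1) \<Rightarrow> real poly \<Rightarrow> 'k \<Rightarrow> 'k" where
  "eval1 h p a = poly (map_poly h p) a"

definition eval2 :: "(real \<Rightarrow> 'k::comm_ring_1) \<Rightarrow> real poly poly \<Rightarrow> 'k \<times> 'k \<Rightarrow> 'k" where
  "eval2 h P z = poly (map_poly (\<lambda>p. eval1 h p (fst z)) P) (snd z)"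

definition eval3 ::
  "(real \<Rightarrow> 'k::comm_ring_1) \<Rightarrow> real poly poly poly \<Rightarrow> 'k \<times> 'k \<times> 'k \<Rightarrow> 'k" where
  "eval3 h G z = poly (map_poly (\<lambda>P. eval2 h P (fst z, fst (snd z))) G) (snd (snd z))"

type_synonym ratfun1 = "real poly fract"
type_synonym ratfun2 = "real poly poly fract"

definition const1 :: "real \<Rightarrow> ratfun1" where
  "const1 c = Fract [:c:] 1"

definition const2 :: "real \<Rightarrow> ratfun2" where
  "const2 c = Fract [:[:c:]:] 1"

definition var_t :: ratfun1 where
  "var_t = Fract [:0, 1:] 1"

definition var_x :: ratfun2 where
  "var_x = Fract [:[:0, 1:]:] 1"

definition var_y :: ratfun2 where
  "var_y = Fract [:0, 1:] 1"

text \<open>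
  \<open>has_value1 h r a v\<close>: the rational function \<open>r\<close> is defined at the point \<open>a\<close>, with value \<open>v\<close>.
  Every representation of \<open>r\<close> as a fraction is allowed.
\<close>

definition has_value1 :: "(real \<Rightarrow> 'k::field) \<Rightarrow> ratfun1 \<Rightarrow> 'k \<Rightarrow> 'k \<Rightarrow> bool" where
  "has_value1 h r a v \<longleftrightarrow>
     (\<exists>p q. r = Fract p q \<and> eval1 h q a \<noteq> 0 \<and> v = eval1 h p a / eval1 h q a)"

definition has_value2 :: "(real \<Rightarrow> 'k::field) \<Rightarrow> ratfun2 \<Rightarrow> 'k \<times> 'k \<Rightarrow> 'k \<Rightarrow> bool" where
  "has_value2 h r z v \<longleftrightarrow>
     (\<exists>P Q. r = Fract P Q \<and> eval2 h Q z \<noteq> 0 \<and> v = eval2 h P z / eval2 h Q z)"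

text \<open>
  A rational map between affine spaces is the tuple of its coordinate functions. With
  \<open>h = const1\<close> or \<open>h = const2\<close> the following say that the composition of rational maps
  \<open>f \<circ> a\<close> (respectively \<open>g \<circ> z\<close>) is defined and equal to the last argument.
\<close>

definition map_value12 ::
  "(real \<Rightarrow> 'k::field) \<Rightarrow> ratfun1 \<times> ratfun1 \<Rightarrow> 'k \<Rightarrow> 'k \<times> 'k \<Rightarrow> bool" where
  "map_value12 h f a w \<longleftrightarrow> has_value1 h (fst f) a (fst w) \<and> has_value1 h (snd f) a (snd w)"

definition map_value22 ::
  "(real \<Rightarrow> 'k::field) \<Rightarrow> ratfun2 \<times> ratfun2 \<Rightarrow> 'k \<times> 'k \<Rightarrow> 'k \<times> 'k \<Rightarrow> bool" where
  "map_value22 h g z w \<longleftrightarrow> has_value2 h (fst g) z (fst w) \<and> has_value2 h (snd g) z (snd w)"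

definition R_regular11 :: "ratfun1 \<Rightarrow> bool" where
  "R_regular11 r \<longleftrightarrow> (\<forall>a::real. \<exists>v. has_value1 (\<lambda>c. c) r a v)"

definition R_regular12 :: "ratfun1 \<times> ratfun1 \<Rightarrow> bool" where
  "R_regular12 f \<longleftrightarrow> (\<forall>a::real. \<exists>w. map_value12 (\<lambda>c. c) f a w)"

definition R_regular22 :: "ratfun2 \<times> ratfun2 \<Rightarrow> bool" where
  "R_regular22 g \<longleftrightarrow> (\<forall>z::real \<times> real. \<exists>w. map_value22 (\<lambda>c. c) g z w)"

definition R_biregular11 :: "ratfun1 \<Rightarrow> bool" where
  "R_biregular11 \<alpha> \<longleftrightarrow> R_regular11 \<alpha> \<and>
     (\<exists>\<alpha>'. R_regular11 \<alpha>' \<and> has_value1 const1 \<alpha> \<alpha>' var_t \<and> has_value1 const1 \<alpha>' \<alpha> var_t)"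

definition R_biregular22 :: "ratfun2 \<times> ratfun2 \<Rightarrow> bool" where
  "R_biregular22 \<beta> \<longleftrightarrow> R_regular22 \<beta> \<and>
     (\<exists>\<beta>'. R_regular22 \<beta>' \<and> map_value22 const2 \<beta> \<beta>' (var_x, var_y)
          \<and> map_value22 const2 \<beta>' \<beta> (var_x, var_y))"

definition j_lin :: "ratfun1 \<times> ratfun1" where
  "j_lin = (var_t, 0)"

definition rectifiable :: "ratfun1 \<times> ratfun1 \<Rightarrow> bool" where
  "rectifiable f \<longleftrightarrow>
     (\<exists>\<alpha> \<beta> g. R_biregular11 \<alpha> \<and> R_biregular22 \<beta> \<and>
        map_value22 const1 \<beta> f g \<and> map_value12 const1 j_lin \<alpha> g)"

definition real_map :: "ratfun1 \<times> ratfun1 \<Rightarrow> real \<Rightarrow> real \<times> real" where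
  "real_map f a = (THE w. map_value12 (\<lambda>c. c) f a w)"

definition closed_smooth_embedding :: "(real \<Rightarrow> real \<times> real) \<Rightarrow> bool" where
  "closed_smooth_embedding \<phi> \<longleftrightarrow>
     (\<forall>n a. ((\<lambda>\<psi> t. vector_derivative \<psi> (at t)) ^^ n) \<phi> differentiable (at a)) \<and>
     (\<forall>a. vector_derivative \<phi> (at a) \<noteq> 0) \<and>
     (\<exists>\<psi>. homeomorphism UNIV (range \<phi>) \<phi> \<psi>) \<and>
     closed (range \<phi>)"

text \<open>
  The scheme-theoretic image of the graph of \<open>f\<close> under the second projection is the closed
  subscheme of the affine plane cut out by the kernel of the pullback \<open>\<real>[x,y] \<rightarrow> \<real>(t)\<close>.
\<close>

definition image_ideal :: "ratfun1 \<times> ratfun1 \<Rightarrow> real poly poly set" where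
  "image_ideal f = {P. eval2 const1 P f = 0}"

text \<open>
  Since \<open>f\<close> always dominates its image, the pullback from the function field of the image to
  \<open>\<real>(t)\<close> is a well-defined field embedding; birationality says that it is onto.
\<close>

definition birational_onto_image :: "ratfun1 \<times> ratfun1 \<Rightarrow> bool" where
  "birational_onto_image f \<longleftrightarrow> (\<forall>r. \<exists>g. has_value2 const1 g f r)"

definition real_points :: "real poly poly set \<Rightarrow> (real \<times> real) set" where
  "real_points I = {z. \<forall>P\<in>I. eval2 (\<lambda>c. c) P z = 0}"

definition tangent_space :: "real poly poly set \<Rightarrow> real \<times> real \<Rightarrow> (real \<times> real) set" where
  "tangent_space I z =
     {v. \<forall>P\<in>I. eval2 (\<lambda>c. c) (map_poly pderiv P) z * fst v
               + eval2 (\<lambda>c. c) (pderiv P) z * snd v = 0}"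

text \<open>For a curve, smoothness at a real point means that the tangent space there is a line.\<close>

definition smooth_at_real_points :: "real poly poly set \<Rightarrow> bool" where
  "smooth_at_real_points I \<longleftrightarrow> (\<forall>z\<in>real_points I. dim (tangent_space I z) = 1)"

definition rational_smooth_embedding :: "ratfun1 \<times> ratfun1 \<Rightarrow> bool" where
  "rational_smooth_embedding f \<longleftrightarrow>
     R_regular12 f \<and> birational_onto_image f \<and>
     closed_smooth_embedding (real_map f) \<and>
     range (real_map f) = real_points (image_ideal f) \<and>
     smooth_at_real_points (image_ideal f)"

definition form2 :: "nat \<Rightarrow> real poly poly \<Rightarrow> bool" where
  "form2 d F \<longleftrightarrow> (\<forall>i j. coeff (coeff F j) i \<noteq> 0 \<longrightarrow> i + j = d)"

definition form3 :: "nat \<Rightarrow> real poly poly poly \<Rightarrow> bool" where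
  "form3 d G \<longleftrightarrow> (\<forall>i j k. coeff (coeff (coeff G k) j) i \<noteq> 0 \<longrightarrow> i + j + k = d)"

text \<open>
  A morphism from the projective line to the projective plane over \<open>\<real>\<close> is given by three
  forms in \<open>u, v\<close> of the same degree without a common zero on the complex projective line.
\<close>

definition projective_morphism ::
  "real poly poly \<times> real poly poly \<times> real poly poly \<Rightarrow> bool" where
  "projective_morphism F \<longleftrightarrow>
     (case F of (F0, F1, F2) \<Rightarrow>
        (\<exists>d. form2 d F0 \<and> form2 d F1 \<and> form2 d F2) \<and>
        (\<forall>z. z \<noteq> (0, 0) \<longrightarrow>
           eval2 complex_of_real F0 z \<noteq> 0 \<or> eval2 complex_of_real F1 z \<noteq> 0 \<or>
           eval2 complex_of_real F2 z \<noteq> 0))"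

text \<open>The affine coordinates are \<open>t = u/v\<close> and \<open>(x, y) = (X/Z, Y/Z)\<close>.\<close>

definition extends_to ::
  "ratfun1 \<times> ratfun1 \<Rightarrow> real poly poly \<times> real poly poly \<times> real poly poly \<Rightarrow> bool" where
  "extends_to f F \<longleftrightarrow> projective_morphism F \<and>
     (case F of (F0, F1, F2) \<Rightarrow>
        eval2 const1 F2 (var_t, 1) \<noteq> 0 \<and>
        f = (eval2 const1 F0 (var_t, 1) / eval2 const1 F2 (var_t, 1),
             eval2 const1 F1 (var_t, 1) / eval2 const1 F2 (var_t, 1)))"

text \<open>
  The curve \<open>C\<close>, the image of the extension, is represented by its ideal in \<open>\<real>[X,Y,Z]\<close>, the
  kernel of \<open>X, Y, Z \<mapsto> F0, F1, F2\<close>. The extension is unique up to a common nonzero scalar,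
  which does not affect this kernel for a nonconstant \<open>f\<close>: there it is a homogeneous ideal.
\<close>

definition associated_curve :: "ratfun1 \<times> ratfun1 \<Rightarrow> real poly poly poly set" where
  "associated_curve f = {H. \<exists>F. extends_to f F \<and> eval3 (\<lambda>c. [:[:c:]:]) H F = 0}"

text \<open>The degree of a plane curve is that of the form generating its ideal.\<close>

definition has_degree :: "real poly poly poly set \<Rightarrow> nat \<Rightarrow> bool" where
  "has_degree I d \<longleftrightarrow> (\<exists>G. G \<noteq> 0 \<and> form3 d G \<and> I = {H. G dvd H})"

end

theory Submission
  imports Defs "HOL-Computational_Algebra.Fundamental_Theorem_Algebra"
begin

text \<open>
  Write \<open>f = (P\<^sub>0/Q, P\<^sub>1/Q)\<close> with numerators and denominator of maximal degree \<open>e\<close> and without a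
  common zero. Intersecting with a generic line shows that \<open>e\<close> is at most the degree of the
  curve. Regularity makes \<open>Q\<close> free of real zeros, and \<open>deg Q < e\<close> because the image is
  unbounded; so for \<open>e \<le> 3\<close> the degree of \<open>Q\<close> is 0 or 2. It suffices to find a linear
  combination of the coordinates that is a polynomial of degree 1 in \<open>t\<close>: then a rotation
  followed by a shear along this combination rectifies \<open>f\<close>. For a cubic such a combination
  exists unless the curve has a unique double point in the affine plane, which is then real.
  This point would contradict injectivity, immersivity or the absence of isolated real points.
\<close>

section \<open>Evaluation homomorphisms\<close>

text \<open>Once some m x + n y restricts to an affine function r of t, the image is the graph of a
  rational function of r whose denominator is \<open>Q\<close> rewritten in r. As it has no real
  zero, the shear and its inverse are regular at all real points. The difficulty lies in the cubics,
  where cancelling the top coefficient does not suffice. Pairs of parameters with the same image are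
  encoded by \<sigma> = s + t and \<pi> = s t. After division by s - t the coordinate conditions are
  equations in (\<sigma>, \<pi>) with real coefficients, and one determinant governs both
  alternatives: if it vanishes, the combination exists; if not, elimination leaves exactly one
  solution, given by real formulas. The parameters s and t may still be conjugate complex numbers.
  This is why f is evaluated at complex points, and why birationality and the ideal of the image are
  exploited there.\<close>

locale ring_map =
  fixes \<phi> :: "'a::comm_ring_1 \<Rightarrow> 'b::comm_ring_1"
  assumes add: "\<phi> (x + y) = \<phi> x + \<phi> y"
    and mult: "\<phi> (x * y) = \<phi> x * \<phi> y"
    and one: "\<phi> 1 = 1"
begin

lemma zero: "\<phi> 0 = 0"
  using add[of 0 0] by simp

lemma uminus: "\<phi> (- x) = - \<phi> x"
  using add[of x "- x"] zero by (simp add: eq_neg_iff_add_eq_0 add.commute)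

lemma diff: "\<phi> (x - y) = \<phi> x - \<phi> y"
  using add[of x "- y"] uminus by simp

lemma sum: "\<phi> (sum g A) = (\<Sum>i\<in>A. \<phi> (g i))"
  by (induction A rule: infinite_finite_induct) (simp_all add: zero add)

lemma eval_pCons:
  "poly (map_poly \<phi> (pCons c p)) a = \<phi> c + a * poly (map_poly \<phi> p) a"
  by (simp add: map_poly_pCons zero)

lemma eval_ring_map: "ring_map (\<lambda>p. poly (map_poly \<phi> p) a)"
proof
  have add': "poly (map_poly \<phi> (p + q)) a = poly (map_poly \<phi> p) a + poly (map_poly \<phi> q) a" for p q
    by (induction p q rule: poly_induct2) (simp_all add: eval_pCons add algebra_simps)
  have smult': "poly (map_poly \<phi> (smult c q)) a = \<phi> c * poly (map_poly \<phi> q) a" for c q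
    by (induction q) (simp_all add: eval_pCons mult algebra_simps)
  show "poly (map_poly \<phi> (p + q)) a = poly (map_poly \<phi> p) a + poly (map_poly \<phi> q) a" for p q
    by (rule add')
  show "poly (map_poly \<phi> (p * q)) a = poly (map_poly \<phi> p) a * poly (map_poly \<phi> q) a" for p q
    by (induction p) (simp_all add: add' smult' eval_pCons zero algebra_simps)
  show "poly (map_poly \<phi> 1) a = 1"
    by (simp add: one)
qed

lemma eval_altdef:
  assumes "degree p \<le> n"
  shows "poly (map_poly \<phi> p) a = (\<Sum>i\<le>n. \<phi> (coeff p i) * a ^ i)"
proof -
  have "degree (map_poly \<phi> p) \<le> n"
    using assms map_poly_degree_leq[of \<phi> p] by simp
  then have "poly (map_poly \<phi> p) a = poly (\<Sum>i\<le>n. monom (coeff (map_poly \<phi> p) i) i) a"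
    by (simp only: poly_as_sum_of_monoms')
  then show ?thesis
    by (simp add: poly_sum poly_monom coeff_map_poly zero)
qed

end

lemma ring_map_compose:
  assumes "ring_map \<phi>" "ring_map \<psi>"
  shows "ring_map (\<lambda>x. \<psi> (\<phi> x))"
proof -
  interpret \<phi>: ring_map \<phi> by fact
  interpret \<psi>: ring_map \<psi> by fact
  show ?thesis
    by unfold_locales (simp_all add: \<phi>.add \<phi>.mult \<phi>.one \<psi>.add \<psi>.mult \<psi>.one)
qed

text \<open>Evaluation commutes with ring maps of the coefficients. Passing from polynomials to
  fractions and from real to complex points are instances.\<close>

lemma eval_natural:
  assumes "ring_map \<phi>" "ring_map \<psi>"
  shows "\<psi> (poly (map_poly \<phi> p) a) = poly (map_poly (\<lambda>x. \<psi> (\<phi> x)) p) (\<psi> a)"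
proof -
  interpret \<phi>: ring_map \<phi> by fact
  interpret \<psi>: ring_map \<psi> by fact
  interpret c: ring_map "\<lambda>x. \<psi> (\<phi> x)" by (rule ring_map_compose) fact+
  show ?thesis
    by (induction p) (simp_all add: \<phi>.eval_pCons c.eval_pCons \<psi>.add \<psi>.mult \<psi>.zero)
qed

lemma ring_map_id: "ring_map (\<lambda>c. c)"
  by unfold_locales simp_all

lemma ring_map_of_real: "ring_map (of_real :: real \<Rightarrow> 'k::{real_algebra_1,comm_ring_1})"
  by unfold_locales simp_all

lemma ring_map_const_poly: "ring_map (\<lambda>c. [:c:])"
  by unfold_locales (simp_all add: one_pCons)

lemma ring_map_Fract: "ring_map (\<lambda>p. Fract p 1)"
  by unfold_locales (simp_all add: One_fract_def)

lemma ring_map_const_poly2: "ring_map (\<lambda>c. [:[:c:]:])"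
  by (intro ring_map_compose[OF ring_map_const_poly ring_map_const_poly])

lemma ring_map_const1: "ring_map const1"
  unfolding const1_def
  by (rule ring_map_compose[OF ring_map_const_poly ring_map_Fract])

lemma ring_map_const2: "ring_map const2"
  unfolding const2_def
  by (rule ring_map_compose[OF ring_map_const_poly2 ring_map_Fract])

lemma ring_map_eval1: "ring_map h \<Longrightarrow> ring_map (\<lambda>p. eval1 h p a)"
  unfolding eval1_def by (rule ring_map.eval_ring_map)

lemma ring_map_eval2: "ring_map h \<Longrightarrow> ring_map (\<lambda>P. eval2 h P z)"
  unfolding eval2_def by (intro ring_map.eval_ring_map ring_map_eval1)

lemma eval1_pCons: "ring_map h \<Longrightarrow> eval1 h (pCons c p) a = h c + a * eval1 h p a"
  unfolding eval1_def by (rule ring_map.eval_pCons)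

lemma eval1_0 [simp]: "eval1 h 0 a = 0"
  by (simp add: eval1_def)

lemma eval2_pCons:
  "ring_map h \<Longrightarrow> eval2 h (pCons p P) z = eval1 h p (fst z) + snd z * eval2 h P z"
  unfolding eval2_def by (rule ring_map.eval_pCons[OF ring_map_eval1])

lemma eval2_0 [simp]: "eval2 h 0 z = 0"
  by (simp add: eval2_def)

lemma eval1_1: "ring_map h \<Longrightarrow> eval1 h 1 a = 1"
  by (rule ring_map.one[OF ring_map_eval1])

lemma eval1_mult: "ring_map h \<Longrightarrow> eval1 h (p * q) a = eval1 h p a * eval1 h q a"
  by (rule ring_map.mult[OF ring_map_eval1])

lemma eval2_1: "ring_map h \<Longrightarrow> eval2 h 1 z = 1"
  by (rule ring_map.one[OF ring_map_eval2])

lemma eval2_add: "ring_map h \<Longrightarrow> eval2 h (P + Q) z = eval2 h P z + eval2 h Q z"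
  by (rule ring_map.add[OF ring_map_eval2])

lemma eval2_diff: "ring_map h \<Longrightarrow> eval2 h (P - Q) z = eval2 h P z - eval2 h Q z"
  by (rule ring_map.diff[OF ring_map_eval2])

lemma eval2_mult: "ring_map h \<Longrightarrow> eval2 h (P * Q) z = eval2 h P z * eval2 h Q z"
  by (rule ring_map.mult[OF ring_map_eval2])

lemma eval1_natural:
  assumes "ring_map h" "ring_map \<psi>"
  shows "\<psi> (eval1 h p a) = eval1 (\<lambda>c. \<psi> (h c)) p (\<psi> a)"
  unfolding eval1_def by (rule eval_natural[OF assms])

lemma eval2_natural:
  assumes "ring_map h" "ring_map \<psi>"
  shows "\<psi> (eval2 h P z) = eval2 (\<lambda>c. \<psi> (h c)) P (map_prod \<psi> \<psi> z)"
  unfolding eval2_def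
  by (simp add: eval_natural[OF ring_map_eval1[OF assms(1)] assms(2)] eval1_natural[OF assms])

lemma eval3_natural:
  assumes "ring_map h" "ring_map \<psi>"
  shows "\<psi> (eval3 h G (a, b, c)) = eval3 (\<lambda>c. \<psi> (h c)) G (\<psi> a, \<psi> b, \<psi> c)"
  unfolding eval3_def
  by (simp add: eval_natural[OF ring_map_eval2[OF assms(1)] assms(2)] eval2_natural[OF assms])

lemma eval1_var: "eval1 (\<lambda>c. [:c:]) p [:0, 1:] = p"
  by (induction p) (simp_all add: eval1_pCons ring_map_const_poly)

lemma eval1_var2: "eval1 (\<lambda>c. [:[:c:]:]) p [:[:0, 1:]:] = [:p:]"
  by (induction p) (simp_all add: eval1_pCons ring_map_const_poly2)

lemma eval2_var: "eval2 (\<lambda>c. [:[:c:]:]) P ([:[:0, 1:]:], [:0, 1:]) = P"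
  by (induction P) (simp_all add: eval2_pCons ring_map_const_poly2 eval1_var2)

lemma eval1_const1_var: "eval1 const1 p var_t = Fract p 1"
  using eval1_natural[OF ring_map_const_poly ring_map_Fract, of p "[:0, 1:]"]
  by (simp add: eval1_var const1_def[abs_def] var_t_def)

lemma eval1_const2: "eval1 const2 p (Fract u 1) = Fract (eval1 (\<lambda>c. [:[:c:]:]) p u) 1"
  using eval1_natural[OF ring_map_const_poly2 ring_map_Fract, of p u]
  by (simp add: const2_def[abs_def])

lemma eval2_const2_var: "eval2 const2 P (var_x, var_y) = Fract P 1"
  using eval2_natural[OF ring_map_const_poly2 ring_map_Fract, of P "([:[:0, 1:]:], [:0, 1:])"]
  by (simp add: const2_def[abs_def] var_x_def var_y_def eval2_var)

lemma eval1_id: "eval1 (\<lambda>c. c) p a = poly p a"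
  by (simp add: eval1_def)

lemma eval1_of_real_real:
  "eval1 of_real p (of_real a) = (of_real (poly p a) :: 'k::{real_algebra_1,comm_ring_1})"
  using eval1_natural[OF ring_map_id ring_map_of_real[where 'k = 'k], of p a]
  by (simp add: eval1_id)

lemma eval2_of_real_real:
  "eval2 of_real P (of_real x, of_real y) =
     (of_real (eval2 (\<lambda>c. c) P (x, y)) :: 'k::{real_algebra_1,comm_ring_1})"
  using eval2_natural[OF ring_map_id ring_map_of_real[where 'k = 'k], of P "(x, y)"]
  by simp

text \<open>The inner evaluation forms the composite polynomial p(u). Evaluation at \<open>z\<close>
  is a ring map that acts on constants as \<open>h\<close>, so naturality moves it inside.\<close>

lemma eval2_eval1:
  assumes "ring_map h"
  shows "eval2 h (eval1 (\<lambda>c. [:[:c:]:]) p u) z = eval1 h p (eval2 h u z)"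
proof -
  have "eval2 h [:[:c:]:] z = h c" for c
    by (simp add: eval2_pCons eval1_pCons assms)
  then show ?thesis
    using eval1_natural[OF ring_map_const_poly2 ring_map_eval2[OF assms, of z], of p u] by simp
qed

section \<open>Values of rational functions at points\<close>

lemma has_value1I:
  "r = Fract p q \<Longrightarrow> eval1 h q a \<noteq> 0 \<Longrightarrow> v = eval1 h p a / eval1 h q a \<Longrightarrow> has_value1 h r a v"
  unfolding has_value1_def by blast

lemma has_value2I:
  "r = Fract P Q \<Longrightarrow> eval2 h Q z \<noteq> 0 \<Longrightarrow> v = eval2 h P z / eval2 h Q z \<Longrightarrow> has_value2 h r z v"
  unfolding has_value2_def by blast

text \<open>Cross-multiplying two representations gives a polynomial identity, which survives
  evaluation; both denominators are nonzero at the point.\<close>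

lemma has_value1_unique:
  assumes h: "ring_map h" and "has_value1 h r a v" "has_value1 h r a w"
  shows "v = w"
proof -
  obtain p q where r: "r = Fract p q" and q: "eval1 h q a \<noteq> 0"
    and v: "v = eval1 h p a / eval1 h q a"
    using assms(2) unfolding has_value1_def by blast
  obtain p' q' where r': "r = Fract p' q'" and q': "eval1 h q' a \<noteq> 0"
    and w: "w = eval1 h p' a / eval1 h q' a"
    using assms(3) unfolding has_value1_def by blast
  have "q \<noteq> 0" "q' \<noteq> 0" using q q' by auto
  then have "p * q' = p' * q" using r r' by (simp add: eq_fract)
  then have "eval1 h p a * eval1 h q' a = eval1 h p' a * eval1 h q a"
    by (metis eval1_mult[OF h])
  then show ?thesis unfolding v w using q q' by (simp add: field_simps)
qed

lemma has_value1_add: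
  assumes h: "ring_map h" and "has_value1 h r a v" "has_value1 h s a w"
  shows "has_value1 h (r + s) a (v + w)"
proof -
  obtain p q where r: "r = Fract p q" and q: "eval1 h q a \<noteq> 0"
    and v: "v = eval1 h p a / eval1 h q a"
    using assms(2) unfolding has_value1_def by blast
  obtain p' q' where r': "s = Fract p' q'" and q': "eval1 h q' a \<noteq> 0"
    and w: "w = eval1 h p' a / eval1 h q' a"
    using assms(3) unfolding has_value1_def by blast
  have "q \<noteq> 0" "q' \<noteq> 0" using q q' by auto
  then have "r + s = Fract (p * q' + p' * q) (q * q')" using r r' by simp
  then show ?thesis
    by (rule has_value1I)
      (use q q' in \<open>simp_all add: v w eval1_mult[OF h] ring_map.add[OF ring_map_eval1[OF h]] field_simps\<close>)
qed

lemma has_value1_mult: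
  assumes h: "ring_map h" and "has_value1 h r a v" "has_value1 h s a w"
  shows "has_value1 h (r * s) a (v * w)"
proof -
  obtain p q where r: "r = Fract p q" and q: "eval1 h q a \<noteq> 0"
    and v: "v = eval1 h p a / eval1 h q a"
    using assms(2) unfolding has_value1_def by blast
  obtain p' q' where r': "s = Fract p' q'" and q': "eval1 h q' a \<noteq> 0"
    and w: "w = eval1 h p' a / eval1 h q' a"
    using assms(3) unfolding has_value1_def by blast
  have "r * s = Fract (p * p') (q * q')" using r r' by simp
  then show ?thesis
    by (rule has_value1I) (use q q' in \<open>simp_all add: v w eval1_mult[OF h]\<close>)
qed

lemma has_value1_Fract:
  "eval1 h q a \<noteq> 0 \<Longrightarrow> has_value1 h (Fract p q) a (eval1 h p a / eval1 h q a)"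
  by (rule has_value1I) simp_all

lemma has_value1_Fract_1:
  assumes "ring_map h"
  shows "has_value1 h (Fract p 1) a (eval1 h p a)"
  using has_value1_Fract[of h 1 a p] by (simp add: eval1_1[OF assms])

lemma has_value1_eval1:
  assumes h: "ring_map h" and r: "has_value1 h r a v"
  shows "has_value1 h (eval1 const1 p r) a (eval1 h p v)"
proof (induction p)
  case 0
  then show ?case using has_value1_Fract_1[OF h, of 0 a] by (simp add: Zero_fract_def)
next
  case (pCons c p)
  have "has_value1 h (const1 c) a (h c)"
    using has_value1_Fract_1[OF h, of "[:c:]" a] by (simp add: const1_def eval1_pCons[OF h])
  then show ?case
    using pCons by (simp add: eval1_pCons h ring_map_const1 has_value1_add has_value1_mult r)
qed

text \<open>Pulling \<open>P\<close> back along \<open>f\<close> and evaluating at \<open>a\<close>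
  amounts to evaluating \<open>P\<close> at the image of \<open>a\<close>. Hence an equation that
  holds identically on the image also holds at the images of complex parameters.\<close>

lemma has_value1_eval2:
  assumes h: "ring_map h" and f: "map_value12 h f a w"
  shows "has_value1 h (eval2 const1 P f) a (eval2 h P w)"
proof (induction P)
  case 0
  then show ?case using has_value1_Fract_1[OF h, of 0 a] by (simp add: Zero_fract_def)
next
  case (pCons c p)
  then show ?case
    using f by (simp add: eval2_pCons h ring_map_const1 has_value1_add has_value1_mult
        has_value1_eval1 map_value12_def)
qed

section \<open>Rectification by a shear\<close>

lemma divide_Fract_1: "q \<noteq> 0 \<Longrightarrow> Fract p 1 / Fract q 1 = Fract p q"
  by simp

lemma R_biregular11_affine:
  assumes "a \<noteq> 0"
  shows "R_biregular11 (Fract [:b, a:] 1)"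
proof -
  have regular: "R_regular11 (Fract p 1)" for p
    unfolding R_regular11_def using has_value1_Fract_1[OF ring_map_id] by blast
  have "has_value1 const1 (Fract [:b, a:] 1) (Fract [:- b / a, 1 / a:] 1) var_t"
    using has_value1_Fract_1[OF ring_map_const1, of "[:b, a:]" "Fract [:- b / a, 1 / a:] 1"] assms
    by (simp add: eval1_pCons ring_map_const1 const1_def var_t_def)
  moreover have "has_value1 const1 (Fract [:- b / a, 1 / a:] 1) (Fract [:b, a:] 1) var_t"
    using has_value1_Fract_1[OF ring_map_const1, of "[:- b / a, 1 / a:]" "Fract [:b, a:] 1"] assms
    by (simp add: eval1_pCons ring_map_const1 const1_def var_t_def)
  ultimately show ?thesis
    unfolding R_biregular11_def using regular by blast
qed

text \<open>
  The rotation \<open>(x, y) \<mapsto> (m x + n y, - n x + m y)\<close> is followed by the shear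
  \<open>(x, y) \<mapsto> (x, y - A(x)/B(x))\<close>; the polynomial \<open>c p\<close> is \<open>p(m x + n y)\<close>.
\<close>

lemma R_biregular22_rotation_shear:
  fixes A B :: "real poly" and m n :: real
  defines "u \<equiv> [:[:0, m:], [:n:]:]" and "w \<equiv> [:[:0, - n:], [:m:]:]"
  defines "c \<equiv> \<lambda>p. eval1 (\<lambda>c. [:[:c:]:]) p u"
  assumes mn: "m\<^sup>2 + n\<^sup>2 = 1" and B: "\<And>x. poly B x \<noteq> 0"
  shows "R_biregular22 (Fract u 1, Fract (w * c B - c A) (c B))"
proof -
  have eval_u: "eval2 h u z = h m * fst z + h n * snd z"
    and eval_w: "eval2 h w z = - h n * fst z + h m * snd z"
    if "ring_map h" for h :: "real \<Rightarrow> 'k::comm_ring_1" and z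
    using that by (simp_all add: u_def w_def eval2_pCons eval1_pCons ring_map.uminus ring_map.zero)
  have eval_c: "eval2 h (c p) z = eval1 h p (eval2 h u z)"
    if "ring_map h" for h :: "real \<Rightarrow> 'k::comm_ring_1" and z p
    unfolding c_def by (rule eval2_eval1[OF that])
  note h = ring_map_const2
  have cB: "c B \<noteq> 0"
  proof
    assume "c B = 0"
    then have "eval1 (\<lambda>c. c) B (eval2 (\<lambda>c. c) u (0, 0)) = 0"
      using eval_c[OF ring_map_id, of B "(0, 0)"] by simp
    then show False using B by (simp add: eval1_id)
  qed
  have B0: "B \<noteq> 0" using B[of 0] by auto
  define X Y :: "real poly poly" where "X = [:[:0, 1:]:]" and "Y = [:0, 1:]"
  \<comment> \<open>Numerators, over the denominator \<open>B\<close>, of the inverse map: the shear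
    adds A(X)/B(X) back to Y, then the transposed rotation is applied.\<close>
  define U V where "U = [:[:m:]:] * X * [:B:] - [:[:n:]:] * (Y * [:B:] + [:A:])"
    and "V = [:[:n:]:] * X * [:B:] + [:[:m:]:] * (Y * [:B:] + [:A:])"
  have B': "[:B:] \<noteq> 0" using B0 by simp
  have eval_XY: "eval2 h X z = fst z" "eval2 h Y z = snd z" "eval2 h [:p:] z = eval1 h p (fst z)"
    if "ring_map h" for h :: "real \<Rightarrow> 'k::comm_ring_1" and z p
    using that by (simp_all add: X_def Y_def eval2_pCons eval1_pCons eval1_1 ring_map.zero ring_map.one)
  have eval_U: "eval2 h U z = h m * fst z * eval1 h B (fst z)
                  - h n * (snd z * eval1 h B (fst z) + eval1 h A (fst z))"
    and eval_V: "eval2 h V z = h n * fst z * eval1 h B (fst z)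
                  + h m * (snd z * eval1 h B (fst z) + eval1 h A (fst z))"
    if "ring_map h" for h :: "real \<Rightarrow> 'k::comm_ring_1" and z
    unfolding U_def V_def
    by (simp_all only: eval2_add[OF that] eval2_diff[OF that] eval2_mult[OF that] eval_XY[OF that])
      (simp_all add: eval1_pCons[OF that] algebra_simps)
  let ?\<beta> = "(Fract u 1, Fract (w * c B - c A) (c B))"
  let ?\<beta>' = "(Fract U [:B:], Fract V [:B:])"
  define x y a b where "x = var_x" and "y = var_y" and "a = Fract [:A:] 1" and "b = Fract [:B:] 1"
  define m' n' where "m' = const2 m" and "n' = const2 n"
  have mn': "m' * m' + n' * n' = 1"
    unfolding m'_def n'_def using mn
    by (simp flip: ring_map.mult[OF h] ring_map.add[OF h] ring_map.one[OF h] add: power2_eq_square)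
  have b0: "b \<noteq> 0" using B0 by (simp add: b_def Zero_fract_def eq_fract)
  have eval_x: "eval1 const2 p x = Fract [:p:] 1" for p
    by (simp add: x_def var_x_def eval1_const2 eval1_var2)
  have U: "Fract U [:B:] = m' * x - n' * (y + a / b)" and V: "Fract V [:B:] = n' * x + m' * (y + a / b)"
  proof -
    have "Fract U [:B:] = eval2 const2 U (x, y) / b"
      unfolding x_def y_def b_def eval2_const2_var by (rule divide_Fract_1[OF B', symmetric])
    also have "\<dots> = m' * x - n' * (y + a / b)"
      using b0 by (simp add: eval_U[OF h] m'_def n'_def eval_x a_def[symmetric] b_def[symmetric] field_simps)
    finally show "Fract U [:B:] = m' * x - n' * (y + a / b)" .
    have "Fract V [:B:] = eval2 const2 V (x, y) / b"
      unfolding x_def y_def b_def eval2_const2_var by (rule divide_Fract_1[OF B', symmetric])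
    also have "\<dots> = n' * x + m' * (y + a / b)"
      using b0 by (simp add: eval_V[OF h] m'_def n'_def eval_x a_def[symmetric] b_def[symmetric] field_simps)
    finally show "Fract V [:B:] = n' * x + m' * (y + a / b)" .
  qed
  have u\<beta>': "eval2 const2 u ?\<beta>' = x"
  proof -
    have "eval2 const2 u ?\<beta>' = (m' * m' + n' * n') * x"
      unfolding eval_u[OF h] fst_conv snd_conv U V m'_def[symmetric] n'_def[symmetric]
      by (simp add: algebra_simps)
    then show ?thesis using mn' by simp
  qed
  have w\<beta>': "eval2 const2 w ?\<beta>' = y + a / b"
  proof -
    have "eval2 const2 w ?\<beta>' = (m' * m' + n' * n') * (y + a / b)"
      unfolding eval_w[OF h] fst_conv snd_conv U V m'_def[symmetric] n'_def[symmetric]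
      by (simp add: algebra_simps)
    then show ?thesis using mn' by simp
  qed
  have \<beta>\<beta>': "map_value22 const2 ?\<beta> ?\<beta>' (var_x, var_y)"
    unfolding map_value22_def fst_conv snd_conv
  proof (intro conjI has_value2I[OF refl])
    show "eval2 const2 1 ?\<beta>' \<noteq> 0" "var_x = eval2 const2 u ?\<beta>' / eval2 const2 1 ?\<beta>'"
      by (simp_all add: eval2_1[OF h] u\<beta>' x_def)
    have c\<beta>': "eval2 const2 (c B) ?\<beta>' = b" "eval2 const2 (c A) ?\<beta>' = a"
      by (simp_all add: eval_c[OF h] u\<beta>' eval_x a_def b_def)
    show "eval2 const2 (c B) ?\<beta>' \<noteq> 0"
      using c\<beta>' b0 by simp
    show "var_y = eval2 const2 (w * c B - c A) ?\<beta>' / eval2 const2 (c B) ?\<beta>'"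
      using b0 by (simp add: eval2_diff[OF h] eval2_mult[OF h] c\<beta>' w\<beta>' y_def field_simps)
  qed
  define r s where "r = Fract u 1" and "s = Fract w 1"
  have r: "r = m' * x + n' * y" and s: "s = - n' * x + m' * y"
    using eval_u[OF h, of "(x, y)"] eval_w[OF h, of "(x, y)"]
    by (simp_all add: r_def s_def x_def y_def eval2_const2_var m'_def n'_def)
  define a' b' where "a' = Fract (c A) 1" and "b' = Fract (c B) 1"
  have b'0: "b' \<noteq> 0" using cB by (simp add: b'_def Zero_fract_def eq_fract)
  have \<beta>2: "Fract (w * c B - c A) (c B) = s - a' / b'"
  proof -
    have "Fract (w * c B - c A) (c B) = (s * b' - a') / b'"
      using cB by (simp add: s_def a'_def b'_def)
    then show ?thesis using b'0 by (simp add: field_simps)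
  qed
  have eval_r: "eval1 const2 A r = a'" "eval1 const2 B r = b'"
    by (simp_all add: r_def a'_def b'_def c_def eval1_const2)
  have \<beta>: "?\<beta> = (r, s - a' / b')"
    by (simp add: \<beta>2 r_def)
  have "map_value22 const2 ?\<beta>' (r, s - a' / b') (var_x, var_y)"
    unfolding map_value22_def fst_conv snd_conv
  proof (intro conjI has_value2I[OF refl])
    have B\<beta>: "eval2 const2 [:B:] (r, s - a' / b') = b'"
      by (simp add: eval_XY[OF h] eval_r)
    show "eval2 const2 [:B:] (r, s - a' / b') \<noteq> 0" "eval2 const2 [:B:] (r, s - a' / b') \<noteq> 0"
      using B\<beta> b'0 by simp_all
    have "m' * r - n' * s = (m' * m' + n' * n') * x" "n' * r + m' * s = (m' * m' + n' * n') * y"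
      unfolding r s by (simp_all add: algebra_simps)
    then have rot: "m' * r - n' * s = x" "n' * r + m' * s = y" using mn' by simp_all
    have "eval2 const2 U (r, s - a' / b') = (m' * r - n' * s) * b'"
      using b'0 by (simp add: eval_U[OF h] eval_r m'_def n'_def field_simps)
    then show "var_x = eval2 const2 U (r, s - a' / b') / eval2 const2 [:B:] (r, s - a' / b')"
      using b'0 by (simp add: rot B\<beta> x_def)
    have "eval2 const2 V (r, s - a' / b') = (n' * r + m' * s) * b'"
      using b'0 by (simp add: eval_V[OF h] eval_r m'_def n'_def field_simps)
    then show "var_y = eval2 const2 V (r, s - a' / b') / eval2 const2 [:B:] (r, s - a' / b')"
      using b'0 by (simp add: rot B\<beta> y_def)
  qed
  then have \<beta>'\<beta>: "map_value22 const2 ?\<beta>' ?\<beta> (var_x, var_y)"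
    by (simp only: \<beta>)
  have val: "\<exists>v. has_value2 (\<lambda>c. c) (Fract P Q) z v"
    if "eval2 (\<lambda>c. c) Q z \<noteq> 0" for P Q and z :: "real \<times> real"
    using that has_value2I[OF refl] by blast
  have pair: "\<exists>p. map_value22 (\<lambda>c. c) g z p"
    if "\<exists>v. has_value2 (\<lambda>c. c) (fst g) z v" "\<exists>v. has_value2 (\<lambda>c. c) (snd g) z v"
    for g and z :: "real \<times> real"
    using that unfolding map_value22_def by auto
  have "R_regular22 ?\<beta>" "R_regular22 ?\<beta>'"
    unfolding R_regular22_def
    by (intro allI pair; simp only: fst_conv snd_conv; intro val;
        simp add: eval2_1[OF ring_map_id] eval_c[OF ring_map_id] eval_XY[OF ring_map_id] eval1_id B)+
  then show ?thesis
    unfolding R_biregular22_def using \<beta>\<beta>' \<beta>'\<beta> by blast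
qed

text \<open>By \<open>comb\<close> the coordinate m x + n y equals b + a t on the image. So t is an
  affine function of it, the orthogonal coordinate is a rational function of it, and a shear
  subtracts the latter.\<close>

lemma rectifiable_of_affine_combination:
  fixes P\<^sub>0 P\<^sub>1 Q :: "real poly"
  assumes f: "f = (Fract P\<^sub>0 Q, Fract P\<^sub>1 Q)" and Q: "\<And>x. poly Q x \<noteq> 0"
    and comb: "smult m P\<^sub>0 + smult n P\<^sub>1 = [:b, a:] * Q" and a: "a \<noteq> 0"
  shows "rectifiable f"
proof -
  have Q0: "Q \<noteq> 0" using Q[of 0] by auto
  have "m \<noteq> 0 \<or> n \<noteq> 0"
    using comb a Q0 mult_eq_0_iff[of "[:b, a:]" Q] by auto
  then have pos: "m\<^sup>2 + n\<^sup>2 > 0" by (simp add: sum_power2_gt_zero_iff)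
  \<comment> \<open>The rotation needs a unit vector; dividing by the norm merely rescales
    \<open>a\<close> and \<open>b\<close>.\<close>
  define l where "l = sqrt (m\<^sup>2 + n\<^sup>2)"
  have l: "l > 0" "l\<^sup>2 = m\<^sup>2 + n\<^sup>2" using pos by (simp_all add: l_def)
  define m' n' a' b' where "m' = m / l" and "n' = n / l" and "a' = a / l" and "b' = b / l"
  have mn': "m'\<^sup>2 + n'\<^sup>2 = 1"
  proof -
    have "m'\<^sup>2 + n'\<^sup>2 = (m\<^sup>2 + n\<^sup>2) / l\<^sup>2"
      by (simp add: m'_def n'_def power_divide add_divide_distrib)
    then show ?thesis using l(2) pos by (metis divide_self less_irrefl)
  qed
  have a': "a' \<noteq> 0" using a l by (simp add: a'_def)
  have comb': "smult m' P\<^sub>0 + smult n' P\<^sub>1 = [:b', a':] * Q"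
  proof -
    have "smult m' P\<^sub>0 + smult n' P\<^sub>1 = smult (1 / l) (smult m P\<^sub>0 + smult n P\<^sub>1)"
      by (simp add: m'_def n'_def smult_add_right)
    also have "\<dots> = [:b', a':] * Q"
      unfolding comb by (simp add: a'_def b'_def smult_add_right)
    finally show ?thesis .
  qed
  \<comment> \<open>\<open>i\<close> inverts t \<mapsto> b' + a' t, so that A/B at b' + a' t is the
    orthogonal coordinate of f at t.\<close>
  define i where "i = [:- b' / a', 1 / a':]"
  define A B where "A = pcompose (smult m' P\<^sub>1 - smult n' P\<^sub>0) i" and "B = pcompose Q i"
  define r where "r = Fract [:b', a':] 1"
  note h = ring_map_const1
  have r_inverse: "eval1 const1 i r = var_t"
    using a' by (simp add: i_def r_def var_t_def eval1_pCons h const1_def)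
  have eval_pcompose: "eval1 const1 (pcompose p i) r = Fract p 1" for p
  proof -
    have "eval1 const1 (pcompose p i) r = eval1 const1 p (eval1 const1 i r)"
      by (induction p)
        (simp_all add: pcompose_pCons eval1_mult eval1_pCons ring_map.add[OF ring_map_eval1] h)
    then show ?thesis by (simp add: r_inverse eval1_const1_var)
  qed
  define u w where "u = [:[:0, m':], [:n':]:]" and "w = [:[:0, - n':], [:m':]:]"
  define c where "c = (\<lambda>p. eval1 (\<lambda>c. [:[:c:]:]) p u)"
  define \<beta> where "\<beta> = (Fract u 1, Fract (w * c B - c A) (c B))"
  have \<beta>: "R_biregular22 \<beta>"
    unfolding \<beta>_def c_def u_def w_def
    by (rule R_biregular22_rotation_shear[OF mn']) (simp add: B_def poly_pcompose Q)
  have const_Fract: "const1 k * Fract p q = Fract (smult k p) q" for k p q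
    by (simp add: const1_def)
  have u_f: "eval2 const1 u f = r"
  proof -
    have "eval2 const1 u f = Fract (smult m' P\<^sub>0) Q + Fract (smult n' P\<^sub>1) Q"
      by (simp add: u_def f eval2_pCons eval1_pCons h ring_map.zero const_Fract mult.commute)
    also have "\<dots> = Fract ((smult m' P\<^sub>0 + smult n' P\<^sub>1) * Q) (Q * Q)"
      by (simp add: add_fract[OF Q0 Q0] algebra_simps del: add_fract)
    also have "\<dots> = r"
      unfolding comb' r_def using Q0 by (simp add: eq_fract algebra_simps)
    finally show ?thesis .
  qed
  have w_f: "eval2 const1 w f = Fract (smult m' P\<^sub>1 - smult n' P\<^sub>0) Q"
  proof -
    have "eval2 const1 w f = Fract (smult m' P\<^sub>1) Q - Fract (smult n' P\<^sub>0) Q"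
      by (simp add: w_def f eval2_pCons eval1_pCons h ring_map.zero ring_map.uminus const_Fract mult.commute
          flip: mult_minus_left)
    also have "\<dots> = Fract ((smult m' P\<^sub>1 - smult n' P\<^sub>0) * Q) (Q * Q)"
      by (simp add: diff_fract[OF Q0 Q0] algebra_simps del: diff_fract)
    also have "\<dots> = Fract (smult m' P\<^sub>1 - smult n' P\<^sub>0) Q"
      using Q0 by (simp add: eq_fract algebra_simps)
    finally show ?thesis .
  qed
  have c_f: "eval2 const1 (c p) f = eval1 const1 p r" for p
    unfolding c_def by (simp add: eval2_eval1[OF h] u_f)
  have Q1: "Fract Q 1 \<noteq> 0" using Q0 by (simp add: Zero_fract_def eq_fract)
  have cB: "eval2 const1 (c B) f = Fract Q 1" and cA: "eval2 const1 (c A) f = Fract (smult m' P\<^sub>1 - smult n' P\<^sub>0) 1"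
    by (simp_all add: c_f A_def B_def eval_pcompose)
  have zero: "eval2 const1 (w * c B - c A) f = 0"
  proof -
    have "eval2 const1 w f * Fract Q 1 = Fract (smult m' P\<^sub>1 - smult n' P\<^sub>0) 1"
      unfolding w_f using Q0 by (simp add: eq_fract)
    then show ?thesis
      by (simp add: eval2_diff[OF h] eval2_mult[OF h] cA cB)
  qed
  have "map_value22 const1 \<beta> f (r, 0)"
    unfolding map_value22_def \<beta>_def fst_conv snd_conv
    by (intro conjI has_value2I[OF refl]) (simp_all add: eval2_1[OF h] u_f cB Q1 zero)
  moreover have "map_value12 const1 j_lin r (r, 0)"
    unfolding map_value12_def j_lin_def fst_conv snd_conv
    using has_value1_Fract_1[OF h, of "[:0, 1:]" r] has_value1_Fract_1[OF h, of 0 r]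
    by (simp add: var_t_def eval1_pCons h ring_map.zero[OF h] ring_map.one[OF h] flip: Zero_fract_def)
  ultimately show ?thesis
    unfolding rectifiable_def using \<beta> R_biregular11_affine[OF a'] unfolding r_def by blast
qed

section \<open>Parametrized embeddings\<close>

text \<open>The extension to the projective line, dehomogenized: \<open>e\<close> is the common
  degree of the three forms, and the two conditions on common zeros exclude base points at infinity
  and at finite complex parameters.\<close>

locale parametrized_embedding =
  fixes f :: "ratfun1 \<times> ratfun1" and P\<^sub>0 P\<^sub>1 Q :: "real poly" and e :: nat
  assumes f: "f = (Fract P\<^sub>0 Q, Fract P\<^sub>1 Q)"
    and Q_nonzero: "Q \<noteq> 0"
    and degree_le: "degree P\<^sub>0 \<le> e" "degree P\<^sub>1 \<le> e" "degree Q \<le> e"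
    and no_common_zero_at_infinity: "coeff P\<^sub>0 e \<noteq> 0 \<or> coeff P\<^sub>1 e \<noteq> 0 \<or> coeff Q e \<noteq> 0"
    and no_common_zero: "eval1 complex_of_real P\<^sub>0 t \<noteq> 0 \<or> eval1 complex_of_real P\<^sub>1 t \<noteq> 0 \<or>
          eval1 complex_of_real Q t \<noteq> 0"
    and embedding: "rational_smooth_embedding f"
begin

text \<open>The map on complex parameters. Division by zero returns 0, so the value has a geometric
  meaning only where \<open>Q\<close> does not vanish.\<close>

definition point :: "complex \<Rightarrow> complex \<times> complex" where
  "point t = (eval1 of_real P\<^sub>0 t / eval1 of_real Q t, eval1 of_real P\<^sub>1 t / eval1 of_real Q t)"

lemma map_value12_point:
  "eval1 complex_of_real Q t \<noteq> 0 \<Longrightarrow> map_value12 of_real f t (point t)"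
  by (simp add: map_value12_def f point_def has_value1_Fract)

text \<open>At a real zero of \<open>Q\<close>, comparison with a representation that is regular
  there forces both numerators to vanish too, which gives a common zero.\<close>

lemma Q_real_nonzero: "poly Q a \<noteq> 0"
proof
  assume Qa: "poly Q a = 0"
  have "R_regular12 f"
    using embedding by (simp add: rational_smooth_embedding_def)
  then have regular: "\<exists>v. has_value1 (\<lambda>c. c) (Fract P Q) a v" if "P = P\<^sub>0 \<or> P = P\<^sub>1" for P
    using that unfolding R_regular12_def map_value12_def f by auto
  have zero: "poly P a = 0" if P: "P = P\<^sub>0 \<or> P = P\<^sub>1" for P
  proof -
    obtain p q where pq: "Fract P Q = Fract p q" "poly q a \<noteq> 0"
      using regular[OF P] by (auto simp: has_value1_def eval1_id)
    moreover have "q \<noteq> 0" using pq by auto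
    ultimately have "P * q = p * Q"
      using Q_nonzero eq_fract(1) by blast
    then have "poly P a * poly q a = 0"
      using Qa by (metis mult_zero_right poly_mult)
    then show ?thesis using pq by simp
  qed
  then show False
    using no_common_zero[of "of_real a"] Qa by (simp add: eval1_of_real_real)
qed

lemma real_map_f: "real_map f a = (poly P\<^sub>0 a / poly Q a, poly P\<^sub>1 a / poly Q a)"
proof -
  have val: "map_value12 (\<lambda>c. c) f a (poly P\<^sub>0 a / poly Q a, poly P\<^sub>1 a / poly Q a)"
    using has_value1_Fract[of "\<lambda>c. c" Q a] Q_real_nonzero[of a]
    by (simp add: map_value12_def f eval1_id)
  then have "w = (poly P\<^sub>0 a / poly Q a, poly P\<^sub>1 a / poly Q a)" if "map_value12 (\<lambda>c. c) f a w" for w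
    using that has_value1_unique[OF ring_map_id] unfolding map_value12_def
    by (metis prod.collapse fst_conv snd_conv)
  then show ?thesis
    unfolding real_map_def using val by blast
qed

lemma real_map_abs: "real_map f = (\<lambda>a. (poly P\<^sub>0 a / poly Q a, poly P\<^sub>1 a / poly Q a))"
  using real_map_f by blast

lemma point_of_real: "point (of_real a) = map_prod of_real of_real (real_map f a)"
  by (simp add: point_def real_map_f eval1_of_real_real)

lemma inj_real_map: "inj (real_map f)"
proof -
  obtain \<psi> where "homeomorphism UNIV (range (real_map f)) (real_map f) \<psi>"
    using embedding unfolding rational_smooth_embedding_def closed_smooth_embedding_def by blast
  then show ?thesis
    by (metis homeomorphism_apply1 UNIV_I injI)
qed

text \<open>These are the numerators of the derivatives of the two coordinates; their joint
  vanishing contradicts immersivity.\<close>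

lemma derivative_nonzero:
  "poly (pderiv P\<^sub>0) a * poly Q a - poly P\<^sub>0 a * poly (pderiv Q) a \<noteq> 0 \<or>
   poly (pderiv P\<^sub>1) a * poly Q a - poly P\<^sub>1 a * poly (pderiv Q) a \<noteq> 0"
proof (rule ccontr)
  assume zero: "\<not> ?thesis"
  have d: "((\<lambda>x. poly P x / poly Q x) has_vector_derivative 0) (at a)"
    if "poly (pderiv P) a * poly Q a - poly P a * poly (pderiv Q) a = 0" for P
  proof -
    have "((\<lambda>x. poly P x / poly Q x) has_real_derivative
            (poly (pderiv P) a * poly Q a - poly P a * poly (pderiv Q) a) / (poly Q a * poly Q a)) (at a)"
      by (intro DERIV_divide poly_DERIV Q_real_nonzero)
    then show ?thesis
      using that by (simp add: has_real_derivative_iff_has_vector_derivative)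
  qed
  have "(real_map f has_vector_derivative (0, 0)) (at a)"
    unfolding real_map_abs using zero by (intro has_vector_derivative_Pair d) simp_all
  then have "vector_derivative (real_map f) (at a) = 0"
    by (simp add: vector_derivative_at zero_prod_def)
  then show False
    using embedding unfolding rational_smooth_embedding_def closed_smooth_embedding_def by blast
qed

lemma image_ideal_point:
  assumes "P \<in> image_ideal f" "eval1 complex_of_real Q t \<noteq> 0"
  shows "eval2 of_real P (point t) = 0"
proof -
  have "has_value1 of_real (eval2 const1 P f) t (eval2 of_real P (point t))"
    by (rule has_value1_eval2[OF ring_map_of_real map_value12_point[OF assms(2)]])
  moreover have "has_value1 of_real (eval2 const1 P f) t (0::complex)"
    using has_value1_Fract_1[OF ring_map_of_real, of 0 t] assms(1)
    by (simp add: image_ideal_def Zero_fract_def)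
  ultimately show ?thesis
    by (rule has_value1_unique[OF ring_map_of_real])
qed

text \<open>The image ideal vanishes at images of complex parameters as well. A real point reached
  in this way is a real point of the curve, and all of those come from real parameters; this is what
  excludes isolated real points.\<close>

lemma real_point_in_range:
  assumes t: "eval1 complex_of_real Q t \<noteq> 0" and z: "point t = (of_real x, of_real y)"
  shows "\<exists>r. point (of_real r) = point t"
proof -
  have "eval2 (\<lambda>c. c) P (x, y) = 0" if "P \<in> image_ideal f" for P
    using image_ideal_point[OF that t] unfolding z eval2_of_real_real of_real_eq_0_iff .
  then have "(x, y) \<in> range (real_map f)"
    using embedding unfolding rational_smooth_embedding_def real_points_def by blast
  then obtain r where "real_map f r = (x, y)"
    by (metis imageE)
  then show ?thesis
    using z by (intro exI[of _ r]) (simp add: point_of_real)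
qed

text \<open>Birationality provides a rational function on the image that recovers t. It inverts the
  parametrization at complex parameters too, as long as its denominator does not vanish
  there.\<close>

lemma generically_injective:
  obtains B where "finite B"
    and "\<And>s t. \<lbrakk>eval1 complex_of_real Q s \<noteq> 0; eval1 complex_of_real Q t \<noteq> 0; s \<notin> B; t \<notin> B;
           point s = point t\<rbrakk> \<Longrightarrow> s = t"
proof -
  obtain g where "has_value2 const1 g f var_t"
    using embedding unfolding rational_smooth_embedding_def birational_onto_image_def by blast
  then obtain N D where D: "eval2 const1 D f \<noteq> 0"
    and t: "var_t = eval2 const1 N f / eval2 const1 D f"
    unfolding has_value2_def by blast
  obtain n d where nd: "eval2 const1 D f = Fract n d" "d \<noteq> 0" "n \<noteq> 0"
    using D by (cases "eval2 const1 D f" rule: Fract_cases_nonzero) auto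
  \<comment> \<open>The denominator \<open>D\<close> pulls back to n/d. By cross-multiplication with
    any other representation, its value can be 0 only at zeros of \<open>n\<close>.\<close>
  define B where "B = {t. eval1 complex_of_real n t = 0}"
  have "map_poly complex_of_real n \<noteq> 0"
    using nd by (simp add: map_poly_eq_0_iff)
  then have "finite B"
    unfolding B_def eval1_def by (rule poly_roots_finite)
  moreover have "s = t" if s: "eval1 complex_of_real Q s \<noteq> 0" "s \<notin> B"
    and t: "eval1 complex_of_real Q t \<noteq> 0" "t \<notin> B" and eq: "point s = point t" for s t
  proof -
    have inverse: "eval2 of_real N (point t) = t * eval2 of_real D (point t) \<and>
        eval2 of_real D (point t) \<noteq> 0" if t: "eval1 complex_of_real Q t \<noteq> 0" "t \<notin> B" for t
    proof
      note h = ring_map_of_real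
      have v: "has_value1 of_real (eval2 const1 N f) t (eval2 of_real N (point t))"
              "has_value1 of_real (eval2 const1 D f) t (eval2 of_real D (point t))"
        by (rule has_value1_eval2[OF h map_value12_point[OF t(1)]])+
      have "eval2 const1 N f = var_t * eval2 const1 D f"
        using \<open>var_t = _\<close> nonzero_eq_divide_eq[OF D] by metis
      moreover have "has_value1 of_real var_t t t"
        using has_value1_Fract_1[OF h, of "[:0, 1:]" t] by (simp add: var_t_def eval1_pCons[OF h])
      ultimately have "has_value1 of_real (eval2 const1 N f) t (t * eval2 of_real D (point t))"
        using v(2) by (simp add: has_value1_mult[OF h])
      with v(1) show "eval2 of_real N (point t) = t * eval2 of_real D (point t)"
        by (rule has_value1_unique[OF h])
      show "eval2 of_real D (point t) \<noteq> 0"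
      proof
        assume zero: "eval2 of_real D (point t) = 0"
        obtain p q where pq: "Fract n d = Fract p q" "eval1 complex_of_real q t \<noteq> 0"
          "eval1 complex_of_real p t = 0"
          using v(2) zero unfolding has_value1_def nd(1) by auto
        then have "n * q = p * d"
          using nd eq_fract(1)[of d q n p] by (metis eval1_0)
        then have "eval1 complex_of_real n t * eval1 of_real q t = 0"
          using pq(3) by (metis eval1_mult[OF h] mult_zero_left)
        then show False using pq(2) t(2) by (simp add: B_def)
      qed
    qed
    show ?thesis
      using inverse[OF s] inverse[OF t] eq by (metis mult_right_cancel)
  qed
  ultimately show ?thesis
    using that by blast
qed

end


section \<open>Degree of the parametrization and degree of an equation of the image\<close>

lemma eval2_altdef:
  assumes h: "ring_map h" and d: "\<And>i j. coeff (coeff P j) i \<noteq> 0 \<Longrightarrow> i + j \<le> d"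
  shows "eval2 h P z = (\<Sum>j\<le>d. \<Sum>i\<le>d. h (coeff (coeff P j) i) * fst z ^ i * snd z ^ j)"
proof -
  have "degree P \<le> d"
  proof (rule degree_le, intro allI impI)
    fix j assume "d < j"
    then have "coeff (coeff P j) i = 0" for i
      using d[of j i] by fastforce
    then show "coeff P j = 0" by (simp add: poly_eq_iff)
  qed
  then have "eval2 h P z = (\<Sum>j\<le>d. eval1 h (coeff P j) (fst z) * snd z ^ j)"
    unfolding eval2_def by (rule ring_map.eval_altdef[OF ring_map_eval1[OF h]])
  also have "\<dots> = (\<Sum>j\<le>d. \<Sum>i\<le>d. h (coeff (coeff P j) i) * fst z ^ i * snd z ^ j)"
  proof (intro sum.cong refl)
    fix j
    have "degree (coeff P j) \<le> d"
    proof (rule degree_le, intro allI impI)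
      fix i assume "d < i"
      then show "coeff (coeff P j) i = 0" using d[of j i] by fastforce
    qed
    then show "eval1 h (coeff P j) (fst z) * snd z ^ j =
        (\<Sum>i\<le>d. h (coeff (coeff P j) i) * fst z ^ i * snd z ^ j)"
      unfolding eval1_def by (simp add: ring_map.eval_altdef[OF h] sum_distrib_right)
  qed
  finally show ?thesis .
qed

lemma eval2_nonvanishing:
  assumes "P \<noteq> 0"
  obtains x y :: real where "eval2 (\<lambda>c. c) P (x, y) \<noteq> 0"
proof -
  obtain j where "coeff P j \<noteq> 0"
    using assms leading_coeff_0_iff by blast
  then obtain x where x: "poly (coeff P j) x \<noteq> 0"
    using poly_all_0_iff_0 by blast
  have "coeff (map_poly (\<lambda>p. eval1 (\<lambda>c. c) p x) P) j \<noteq> 0"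
    using x by (simp add: coeff_map_poly eval1_id)
  then have "map_poly (\<lambda>p. eval1 (\<lambda>c. c) p x) P \<noteq> 0"
    by (metis coeff_0)
  then obtain y where "poly (map_poly (\<lambda>p. eval1 (\<lambda>c. c) p x) P) y \<noteq> 0"
    using poly_all_0_iff_0 by blast
  then show ?thesis
    using that[of x y] by (simp add: eval2_def)
qed

lemma card_roots_rsquarefree:
  fixes p :: "complex poly"
  assumes "rsquarefree p"
  shows "card {z. poly p z = 0} = degree p"
proof -
  have "p \<noteq> 0" using assms by (simp add: rsquarefree_def)
  have "degree p = degree (\<Prod>z | poly p z = 0. [:- z, 1:])"
    by (subst complex_poly_decompose_rsquarefree[OF assms, symmetric]) (simp add: \<open>p \<noteq> 0\<close>)
  also have "\<dots> = (\<Sum>z | poly p z = 0. degree [:- z, 1:])"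
    by (rule degree_prod_sum_eq) simp
  also have "\<dots> = card {z. poly p z = 0}" by simp
  finally show ?thesis ..
qed

text \<open>The leading coefficients of the two products are one and the same number multiplied by
  the degree of \<open>X\<close> and the degree of \<open>q\<close> respectively, and these degrees
  differ.\<close>

lemma wronskian_nonzero:
  fixes X q :: "complex poly"
  assumes "degree q < degree X" "q \<noteq> 0"
  shows "pderiv X * q - X * pderiv q \<noteq> 0"
proof
  assume "pderiv X * q - X * pderiv q = 0"
  then have eq: "pderiv X * q = X * pderiv q" by simp
  have lead: "lead_coeff (pderiv p) = of_nat (degree p) * lead_coeff p" for p :: "complex poly"
    by (cases "degree p") (simp_all add: degree_pderiv coeff_pderiv coeff_eq_0)
  have "lead_coeff (pderiv X * q) = lead_coeff (X * pderiv q)"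
    by (simp only: eq)
  then have "of_nat (degree X) * lead_coeff X * lead_coeff q =
      of_nat (degree q) * lead_coeff X * lead_coeff q"
    unfolding lead_coeff_mult lead by (simp add: mult_ac)
  moreover have "lead_coeff X \<noteq> 0" "lead_coeff q \<noteq> 0"
    using assms by auto
  ultimately have "(of_nat (degree X) :: complex) = of_nat (degree q)"
    by simp
  then show False using assms by simp
qed

context parametrized_embedding
begin

text \<open>If \<open>Q\<close> had degree \<open>e\<close>, both coordinates would extend
  continuously to infinity and be bounded. The image, being closed, would then be compact, yet it is
  homeomorphic to the line.\<close>

lemma degree_Q_less: "degree Q < e"
proof (rule ccontr)
  assume "\<not> degree Q < e"
  then have deg: "degree Q = e" using degree_le by simp
  \<comment> \<open>\<open>H P s\<close> is s^e P(1/s), written with the reflected polynomial so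
    that it makes sense at s = 0. There \<open>H Q\<close> is the leading coefficient of
    \<open>Q\<close>.\<close>
  define H :: "real poly \<Rightarrow> real \<Rightarrow> real"
    where "H P s = s ^ (e - degree P) * poly (reflect_poly P) s" for P s
  have H: "H P s = s ^ e * poly P (inverse s)" if "s \<noteq> 0" "degree P \<le> e" for P s
    using that by (simp add: H_def poly_reflect_poly_nz flip: power_add mult.assoc)
  have HQ: "H Q s \<noteq> 0" for s
  proof (cases "s = 0")
    case True
    then show ?thesis using Q_nonzero by (simp add: H_def flip: deg)
  next
    case False
    then show ?thesis using Q_real_nonzero by (simp add: H deg)
  qed
  have bounded: "bounded (range (\<lambda>t. poly P t / poly Q t))" if P: "degree P \<le> e" for P
  proof -
    have "compact ((\<lambda>t. poly P t / poly Q t) ` {-1..1})"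
      using Q_real_nonzero by (intro compact_continuous_image continuous_intros) auto
    moreover have "compact ((\<lambda>s. H P s / H Q s) ` {-1..1})"
      using HQ unfolding H_def by (intro compact_continuous_image continuous_intros) auto
    ultimately have "bounded ((\<lambda>t. poly P t / poly Q t) ` {-1..1} \<union> (\<lambda>s. H P s / H Q s) ` {-1..1})"
      by (intro bounded_Un[THEN iffD2] conjI compact_imp_bounded)
    moreover have "range (\<lambda>t. poly P t / poly Q t)
        \<subseteq> (\<lambda>t. poly P t / poly Q t) ` {-1..1} \<union> (\<lambda>s. H P s / H Q s) ` {-1..1}"
    proof (rule image_subsetI)
      fix t :: real
      show "poly P t / poly Q t \<in>
          (\<lambda>t. poly P t / poly Q t) ` {-1..1} \<union> (\<lambda>s. H P s / H Q s) ` {-1..1}"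
      proof (cases "t \<in> {-1..1}")
        case False
        then have "t \<noteq> 0" "\<bar>t\<bar> > 1" by auto
        then have "\<bar>inverse t\<bar> \<le> 1" by (simp add: abs_inverse inverse_le_1_iff)
        then have "inverse t \<in> {-1..1}"
          unfolding abs_le_iff atLeastAtMost_iff by linarith
        moreover have "poly P t / poly Q t = H P (inverse t) / H Q (inverse t)"
          using \<open>t \<noteq> 0\<close> by (simp add: H P deg)
        ultimately show ?thesis by blast
      qed blast
    qed
    ultimately show ?thesis by (rule bounded_subset)
  qed
  have "range (real_map f) \<subseteq>
      range (\<lambda>t. poly P\<^sub>0 t / poly Q t) \<times> range (\<lambda>t. poly P\<^sub>1 t / poly Q t)"
    by (auto simp: real_map_f)
  then have "bounded (range (real_map f))"
    by (rule bounded_subset[rotated]) (intro bounded_Times bounded degree_le)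
  moreover have "closed (range (real_map f))"
    and "\<exists>\<psi>. homeomorphism UNIV (range (real_map f)) (real_map f) \<psi>"
    using embedding unfolding rational_smooth_embedding_def closed_smooth_embedding_def by blast+
  ultimately have "compact (UNIV :: real set)"
    by (metis compact_eq_bounded_closed homeomorphism_def compact_continuous_image)
  then show False by simp
qed

text \<open>
  This is Bezout's theorem for the image of \<open>f\<close> and a line \<open>x + \<mu> y = c\<close>: for generic complex
  \<open>\<mu>\<close> and \<open>c\<close> the line meets the image in \<open>e\<close> distinct points, on which \<open>P\<close> vanishes.
\<close>

lemma parametrization_degree_le:
  assumes P: "P \<noteq> 0" "P \<in> image_ideal f"
    and d: "\<And>i j. coeff (coeff P j) i \<noteq> 0 \<Longrightarrow> i + j \<le> d"
  shows "e \<le> d"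
proof -
  define p\<^sub>0 p\<^sub>1 q where "p\<^sub>0 = map_poly complex_of_real P\<^sub>0"
    and "p\<^sub>1 = map_poly complex_of_real P\<^sub>1" and "q = map_poly complex_of_real Q"
  have ev: "eval1 of_real P\<^sub>0 = poly p\<^sub>0" "eval1 of_real P\<^sub>1 = poly p\<^sub>1" "eval1 of_real Q = poly q"
    by (auto simp: eval1_def p\<^sub>0_def p\<^sub>1_def q_def)
  have point: "point t = (poly p\<^sub>0 t / poly q t, poly p\<^sub>1 t / poly q t)" for t
    by (simp add: point_def ev)
  have q0: "q \<noteq> 0"
    unfolding q_def using Q_nonzero by (simp add: map_poly_eq_0_iff)
  have deg_q: "degree q < e"
    using degree_Q_less map_poly_degree_leq[of complex_of_real Q] unfolding q_def by simp
  have coeffs: "coeff p\<^sub>0 i = of_real (coeff P\<^sub>0 i)" "coeff p\<^sub>1 i = of_real (coeff P\<^sub>1 i)" for i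
    by (simp_all add: p\<^sub>0_def p\<^sub>1_def coeff_map_poly)
  have top: "coeff p\<^sub>0 e \<noteq> 0 \<or> coeff p\<^sub>1 e \<noteq> 0"
    using no_common_zero_at_infinity degree_Q_less by (simp add: coeffs coeff_eq_0)
  have deg_p: "degree p\<^sub>0 \<le> e" "degree p\<^sub>1 \<le> e"
    using degree_le map_poly_degree_leq[of complex_of_real] unfolding p\<^sub>0_def p\<^sub>1_def
    by (meson order_trans)+
  have no_common: "poly p\<^sub>0 t \<noteq> 0 \<or> poly p\<^sub>1 t \<noteq> 0" if "poly q t = 0" for t
    using no_common_zero[of t] that by (simp add: ev)

  \<comment> \<open>The excluded values of \<mu> are those for which \<open>X\<close> below would
    drop in degree or share a zero with \<open>q\<close>, that is, for which the line meets the
    curve at infinity.\<close>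
  have "finite (insert (- coeff p\<^sub>0 e / coeff p\<^sub>1 e) ((\<lambda>t. - poly p\<^sub>0 t / poly p\<^sub>1 t) ` {t. poly q t = 0}))"
    using poly_roots_finite[OF q0] by simp
  then obtain \<mu> where \<mu>: "\<mu> \<noteq> - coeff p\<^sub>0 e / coeff p\<^sub>1 e"
      "\<And>t. poly q t = 0 \<Longrightarrow> \<mu> \<noteq> - poly p\<^sub>0 t / poly p\<^sub>1 t"
    using ex_new_if_finite[OF infinite_UNIV_char_0[where 'a = complex]] by blast
  define X where "X = p\<^sub>0 + smult \<mu> p\<^sub>1"
  have avoid: "a + \<mu> * b \<noteq> 0" if "\<mu> \<noteq> - a / b" "a \<noteq> 0 \<or> b \<noteq> 0" for a b
    using that by (cases "b = 0") (auto simp: field_simps add_eq_0_iff)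
  have X_e: "coeff X e \<noteq> 0"
    unfolding X_def using avoid[OF \<mu>(1) top] by simp
  have X_q: "poly X t \<noteq> 0" if "poly q t = 0" for t
    unfolding X_def using avoid[OF \<mu>(2)[OF that] no_common[OF that]] by simp
  have deg_X: "degree X = e"
  proof (rule antisym)
    show "degree X \<le> e"
      unfolding X_def using deg_p by (intro degree_add_le order_trans[OF degree_smult_le])
    show "e \<le> degree X" using X_e by (rule le_degree)
  qed
  \<comment> \<open>W/q^2 is the derivative of x + \<mu> y along the parametrization, so zeros of
    \<open>W\<close> are the parameters of multiple intersection.\<close>
  define W where "W = pderiv X * q - X * pderiv q"
  have W0: "W \<noteq> 0"
    unfolding W_def using deg_q deg_X q0 by (intro wronskian_nonzero) simp_all

  define k where "k = (\<lambda>r. [:complex_of_real r:])"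
  have k: "ring_map k"
    unfolding k_def by (rule ring_map_compose[OF ring_map_of_real ring_map_const_poly])
  have poly_eval2: "poly (eval2 k P z) a = eval2 of_real P (poly (fst z) a, poly (snd z) a)" for z a
    using eval2_natural[OF k, of "\<lambda>p. poly p a" P z]
    by (simp add: k_def ring_map_def map_prod_def split_beta)
  obtain x\<^sub>0 y\<^sub>0 where nonvanishing: "eval2 (\<lambda>c. c) P (x\<^sub>0, y\<^sub>0) \<noteq> 0"
    using eval2_nonvanishing[OF P(1)] .
  \<comment> \<open>\<open>P\<close> restricted to y = \<open>y\<^sub>0\<close>, as a polynomial in
    c = x + \<mu> y. Where it is nonzero, \<open>P\<close> does not vanish identically on the line x
    + \<mu> y = c.\<close>
  define \<psi> where "\<psi> = eval2 k P ([:- \<mu> * of_real y\<^sub>0, 1:], [:of_real y\<^sub>0:])"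
  have "poly \<psi> (of_real x\<^sub>0 + \<mu> * of_real y\<^sub>0) = of_real (eval2 (\<lambda>c. c) P (x\<^sub>0, y\<^sub>0))"
    unfolding \<psi>_def poly_eval2 eval2_of_real_real[symmetric] by simp
  then have \<psi>0: "\<psi> \<noteq> 0" using nonvanishing by auto

  obtain B where B: "finite B"
    "\<And>s t. \<lbrakk>poly q s \<noteq> 0; poly q t \<noteq> 0; s \<notin> B; t \<notin> B; point s = point t\<rbrakk> \<Longrightarrow> s = t"
    using generically_injective unfolding ev by blast
  have "finite ({c. poly \<psi> c = 0} \<union> (\<lambda>t. poly X t / poly q t) ` ({t. poly W t = 0} \<union> B))"
    using poly_roots_finite[OF \<psi>0] poly_roots_finite[OF W0] B(1) by simp
  then obtain c where c: "poly \<psi> c \<noteq> 0"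
      "\<And>t. poly W t = 0 \<or> t \<in> B \<Longrightarrow> c \<noteq> poly X t / poly q t"
    using ex_new_if_finite[OF infinite_UNIV_char_0[where 'a = complex]] by blast
  define R where "R = X - smult c q"
  define T where "T = {t. poly R t = 0}"
  have deg_R: "degree R = e"
  proof (rule antisym)
    show "degree R \<le> e"
      unfolding R_def using deg_X deg_q
      by (intro degree_diff_le order_trans[OF degree_smult_le]) simp_all
    show "e \<le> degree R"
      using X_e deg_q by (intro le_degree) (simp add: R_def coeff_eq_0)
  qed
  have q_T: "poly q t \<noteq> 0" and c_T: "poly X t / poly q t = c" if "t \<in> T" for t
  proof -
    have Xt: "poly X t = c * poly q t" using that by (simp add: T_def R_def)
    show "poly q t \<noteq> 0" using X_q Xt by force
    then show "poly X t / poly q t = c" using Xt by simp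
  qed
  \<comment> \<open>A multiple root of \<open>R\<close> would be a zero of \<open>W\<close> at which
    x + \<mu> y takes the value \<open>c\<close>, and \<open>c\<close> was chosen to avoid such
    values.\<close>
  have "rsquarefree R"
    unfolding rsquarefree_roots
  proof (intro allI notI, elim conjE)
    fix t assume t: "poly R t = 0" "poly (pderiv R) t = 0"
    then have "poly W t = 0"
      by (simp add: W_def R_def pderiv_diff pderiv_smult algebra_simps)
    moreover have "t \<in> T" using t by (simp add: T_def)
    ultimately show False using c(2) c_T by blast
  qed
  then have card_T: "card T = e"
    unfolding T_def by (simp add: card_roots_rsquarefree deg_R)
  define \<phi> where "\<phi> = eval2 k P ([:c, - \<mu>:], [:0, 1:])"
  have "poly \<phi> (of_real y\<^sub>0) = poly \<psi> c"
    unfolding \<phi>_def \<psi>_def poly_eval2 by (simp add: algebra_simps)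
  then have \<phi>0: "\<phi> \<noteq> 0" using c(1) by auto
  have eval_sum: "eval2 k P z = (\<Sum>j\<le>d. \<Sum>i\<le>d. k (coeff (coeff P j) i) * fst z ^ i * snd z ^ j)" for z
    by (rule eval2_altdef[OF k]) (rule d)
  have deg_\<phi>: "degree \<phi> \<le> d"
    unfolding \<phi>_def eval_sum
  proof (intro degree_sum_le finite_atMost)
    fix i j
    show "degree (k (coeff (coeff P j) i) * fst ([:c, - \<mu>:], [:0, 1:]) ^ i
                    * snd ([:c, - \<mu>:], [:0, 1:]) ^ j) \<le> d"
    proof (cases "coeff (coeff P j) i = 0")
      case False
      have "degree ([:c, - \<mu>:] ^ i) \<le> i" "degree ([:0, 1 :: complex:] ^ j) \<le> j"
        using degree_power_le[of "[:c, - \<mu>:]" i] degree_power_le[of "[:0, 1 :: complex:]" j]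
        by (auto split: if_splits)
      then have "degree (k (coeff (coeff P j) i) * [:c, - \<mu>:] ^ i * [:0, 1:] ^ j) \<le> 0 + i + j"
        by (intro order_trans[OF degree_mult_le] add_mono) (simp_all add: k_def)
      then show ?thesis using d[OF False] by simp
    qed (simp add: k_def)
  qed
  have p\<^sub>0: "poly p\<^sub>0 t / poly q t = c - \<mu> * (poly p\<^sub>1 t / poly q t)" if "t \<in> T" for t
  using c_T[OF that] by (simp add: X_def add_divide_distrib algebra_simps)
  \<comment> \<open>On the line, x is determined by y, so injectivity outside \<open>B\<close> gives
    distinct parameters in \<open>T\<close> distinct y-coordinates, all of them roots of
    \<phi>.\<close>
  have "card T \<le> card {y. poly \<phi> y = 0}"
  proof (rule card_inj_on_le)
    show "inj_on (\<lambda>t. poly p\<^sub>1 t / poly q t) T"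
    proof (rule inj_onI)
      fix s t assume st: "s \<in> T" "t \<in> T" and eq: "poly p\<^sub>1 s / poly q s = poly p\<^sub>1 t / poly q t"
      have "point s = point t"
        unfolding point prod.inject p\<^sub>0[OF st(1)] p\<^sub>0[OF st(2)] eq by simp
      moreover have "s \<notin> B" "t \<notin> B" using c(2) c_T st by blast+
      ultimately show "s = t" using B(2) q_T st by blast
    qed
    show "(\<lambda>t. poly p\<^sub>1 t / poly q t) ` T \<subseteq> {y. poly \<phi> y = 0}"
    proof (rule image_subsetI, rule CollectI)
      fix t assume t: "t \<in> T"
      have "poly \<phi> (poly p\<^sub>1 t / poly q t) = eval2 of_real P (point t)"
        unfolding \<phi>_def poly_eval2 point p\<^sub>0[OF t] by (simp add: algebra_simps)
      then show "poly \<phi> (poly p\<^sub>1 t / poly q t) = 0"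
        using image_ideal_point[OF P(2)] q_T[OF t] by (simp add: ev)
    qed
    show "finite {y. poly \<phi> y = 0}" by (rule poly_roots_finite[OF \<phi>0])
  qed
  then show ?thesis
    using deg_\<phi> card_T card_poly_roots_bound[OF \<phi>0] by simp
qed

section \<open>Double points of the parametrized curve\<close>

lemma eval1_of_real_cnj: "eval1 complex_of_real p (cnj t) = cnj (eval1 of_real p t)"
  using eval1_natural[OF ring_map_of_real[where 'k = complex], of cnj p t] by (simp add: ring_map_def)

text \<open>
  \<open>E\<^sub>0\<close> and \<open>E\<^sub>1\<close> express the difference quotients of the two coordinates in the elementary
  symmetric functions of the two parameters. A real zero \<open>(\<sigma>, \<pi>)\<close> is a double point with two
  real branches, with a cuspidal branch or with two conjugate branches, that is, isolated.
\<close>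

lemma no_unique_double_point:
  fixes E\<^sub>0 E\<^sub>1 :: "complex \<Rightarrow> complex \<Rightarrow> complex" and \<sigma> \<pi> :: real
  assumes E\<^sub>0: "\<And>s t. eval1 of_real P\<^sub>0 s * eval1 of_real Q t - eval1 of_real P\<^sub>0 t * eval1 of_real Q s
                = (s - t) * E\<^sub>0 (s + t) (s * t)"
    and E\<^sub>1: "\<And>s t. eval1 of_real P\<^sub>1 s * eval1 of_real Q t - eval1 of_real P\<^sub>1 t * eval1 of_real Q s
                = (s - t) * E\<^sub>1 (s + t) (s * t)"
    and D\<^sub>0: "\<And>t. complex_of_real (poly (pderiv P\<^sub>0) t * poly Q t - poly P\<^sub>0 t * poly (pderiv Q) t)
                = E\<^sub>0 (of_real (2 * t)) (of_real (t * t))"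
    and D\<^sub>1: "\<And>t. complex_of_real (poly (pderiv P\<^sub>1) t * poly Q t - poly P\<^sub>1 t * poly (pderiv Q) t)
                = E\<^sub>1 (of_real (2 * t)) (of_real (t * t))"
    and zero: "E\<^sub>0 (of_real \<sigma>) (of_real \<pi>) = 0" "E\<^sub>1 (of_real \<sigma>) (of_real \<pi>) = 0"
    and finite_point: "\<And>s t. \<lbrakk>s + t = of_real \<sigma>; s * t = of_real \<pi>\<rbrakk> \<Longrightarrow> eval1 complex_of_real Q s \<noteq> 0"
    and unique: "\<And>s t. \<lbrakk>eval1 complex_of_real Q s \<noteq> 0; eval1 complex_of_real Q t \<noteq> 0;
                   E\<^sub>0 (s + t) (s * t) = 0; E\<^sub>1 (s + t) (s * t) = 0\<rbrakk> \<Longrightarrow> s + t = of_real \<sigma>"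
  shows False
proof -
  have double: "point s = point t \<and> eval1 complex_of_real Q s \<noteq> 0" if st: "s + t = of_real \<sigma>" "s * t = of_real \<pi>" for s t
  proof -
    have "eval1 complex_of_real Q s \<noteq> 0" "eval1 complex_of_real Q t \<noteq> 0"
      using finite_point[of s t] finite_point[of t s] st by (simp_all add: ac_simps)
    then show ?thesis
      using E\<^sub>0[of s t] E\<^sub>1[of s t] zero st by (simp add: point_def field_simps)
  qed
  \<comment> \<open>The two parameters are the roots of T^2 - \<sigma> T + \<pi>; its discriminant
    decides whether they are real and distinct, equal, or conjugate.\<close>
  consider "\<sigma>\<^sup>2 > 4 * \<pi>" | "\<sigma>\<^sup>2 = 4 * \<pi>" | "\<sigma>\<^sup>2 < 4 * \<pi>" by linarith
  then show False
  proof cases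
    case 1
    define D s t where "D = sqrt (\<sigma>\<^sup>2 - 4 * \<pi>)" and "s = (\<sigma> + D) / 2" and "t = (\<sigma> - D) / 2"
    have D: "D > 0" "D\<^sup>2 = \<sigma>\<^sup>2 - 4 * \<pi>" using 1 by (simp_all add: D_def)
    have "s + t = \<sigma>" by (simp add: s_def t_def field_simps)
    moreover have "s * t = \<pi>" using D(2) by (simp add: s_def t_def field_simps power2_eq_square)
    ultimately have "point (of_real s) = point (of_real t)"
      using double by (metis of_real_add of_real_mult)
    then have "real_map f s = real_map f t"
      by (simp add: point_of_real map_prod_def split_beta prod_eq_iff)
    then have "s = t" using inj_real_map by (simp add: inj_eq)
    then show False using D(1) by (simp add: s_def t_def)
  next
    case 2
    define t where "t = \<sigma> / 2"
    have "2 * t = \<sigma>" "t * t = \<pi>" using 2 by (simp_all add: t_def power2_eq_square)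
    then show False
      using D\<^sub>0[of t] D\<^sub>1[of t] zero derivative_nonzero[of t] by (metis of_real_eq_0_iff)
  next
    case 3
    define D s where "D = sqrt (4 * \<pi> - \<sigma>\<^sup>2)" and "s = Complex (\<sigma> / 2) (D / 2)"
    have D: "D > 0" "D\<^sup>2 = 4 * \<pi> - \<sigma>\<^sup>2" using 3 by (simp_all add: D_def)
    have sum: "s + cnj s = of_real \<sigma>"
      by (simp add: s_def complex_eq_iff)
    have "s * cnj s = of_real \<pi>"
      using D(2) by (simp add: s_def complex_eq_iff power2_eq_square field_simps)
    note s = double[OF sum this]
    have "point (cnj s) = map_prod cnj cnj (point s)"
      by (simp add: point_def eval1_of_real_cnj)
    \<comment> \<open>Conjugate parameters have conjugate images, and here the two images coincide,
      so the point is real.\<close>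
    then have "cnj (fst (point s)) = fst (point s)" "cnj (snd (point s)) = snd (point s)"
      using s by (metis fst_map_prod, metis snd_map_prod)
    then obtain x y where xy: "point s = (of_real x, of_real y)"
      by (metis Reals_cases Reals_cnj_iff prod.collapse)
    obtain r where r: "point (of_real r) = point s"
      using real_point_in_range[OF _ xy] s by blast
    have Qr: "eval1 complex_of_real Q (of_real r) \<noteq> 0"
      using Q_real_nonzero by (simp add: eval1_of_real_real)
    \<comment> \<open>The real parameter \<open>r\<close> is a third preimage besides
      \<open>s\<close> and its conjugate. The pair (r, s) then solves the same equations, and
      uniqueness of the sum forces \<open>s\<close> to be real.\<close>
    have "of_real r \<noteq> s"
      using D(1) by (auto simp: s_def complex_eq_iff)
    then have "E\<^sub>0 (of_real r + s) (of_real r * s) = 0" "E\<^sub>1 (of_real r + s) (of_real r * s) = 0"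
      using E\<^sub>0[of "of_real r" s] E\<^sub>1[of "of_real r" s] r s Qr by (auto simp: point_def field_simps)
    then have "of_real r + s = of_real \<sigma>"
      using unique Qr s by blast
    then have "Im s = 0" by (simp add: complex_eq_iff)
    then show False using D(1) by (simp add: s_def)
  qed
qed

end

section \<open>Cubic parametrizations\<close>

lemma degree_le_cubic:
  assumes "degree p \<le> 3"
  shows "p = [:coeff p 0, coeff p 1, coeff p 2, coeff p 3:]"
proof (rule poly_eqI)
  fix i :: nat
  consider "i = 0" | "i = 1" | "i = 2" | "i = 3" | "i > 3" by linarith
  then show "coeff p i = coeff [:coeff p 0, coeff p 1, coeff p 2, coeff p 3:] i"
    using assms by cases (simp_all add: coeff_pCons coeff_eq_0 numeral_eq_Suc split: nat.split)
qed

context parametrized_embedding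
begin

text \<open>If \<open>a\<close> is 0, the image lies on the line m x + n y = b, and an equation of
  degree 1 bounds \<open>e\<close> by 1. Otherwise the shear applies.\<close>

lemma rectifiable_of_linear_combination:
  assumes "2 \<le> e" "m \<noteq> 0 \<or> n \<noteq> 0" and comb: "smult m P\<^sub>0 + smult n P\<^sub>1 = [:b, a:] * Q"
  shows "rectifiable f"
proof (cases "a = 0")
  case False
  then show ?thesis
    by (rule rectifiable_of_affine_combination[OF f Q_real_nonzero comb])
next
  case True
  define P where "P = [:[:- b, m:], [:n:]:]"
  note h = ring_map_const1
  have "eval2 const1 P f = const1 m * Fract P\<^sub>0 Q + const1 n * Fract P\<^sub>1 Q - const1 b"
    by (simp add: P_def f eval2_pCons eval1_pCons ring_map.uminus h mult.commute)
  also have "\<dots> = Fract (smult m P\<^sub>0 + smult n P\<^sub>1) Q - const1 b"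
    using Q_nonzero by (simp add: const1_def eq_fract algebra_simps)
  also have "\<dots> = 0"
    unfolding comb True using Q_nonzero by (simp add: const1_def eq_fract fract_collapse)
  finally have P: "P \<in> image_ideal f" by (simp add: image_ideal_def)
  have "P \<noteq> 0" using assms(2) by (auto simp: P_def)
  moreover have "i + j \<le> 1" if "coeff (coeff P j) i \<noteq> 0" for i j
    using that by (auto simp: P_def coeff_pCons split: nat.splits)
  ultimately have "e \<le> 1" using parametrization_degree_le[of P 1] P by blast
  then show ?thesis using assms(1) by simp
qed

text \<open>Some numerator has a nonzero top coefficient, so one of the coordinates is itself affine
  in t.\<close>

lemma rectifiable_polynomial_degree_1:
  assumes "e = 1" "degree Q = 0"
  shows "rectifiable f"
proof -
  obtain q where Q: "Q = [:q:]" using assms(2) degree_0_id by metis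
  then have q: "q \<noteq> 0" using Q_nonzero by auto
  have linear: "P = [:coeff P 0 / q, coeff P 1 / q:] * Q" if "degree P \<le> 1" for P
    using degree_le_cubic[of P] that q by (simp add: Q coeff_eq_0)
  show ?thesis
  proof (cases "coeff P\<^sub>0 1 = 0")
    case False
    show ?thesis
    proof (rule rectifiable_of_affine_combination[OF f Q_real_nonzero])
      show "smult 1 P\<^sub>0 + smult 0 P\<^sub>1 = [:coeff P\<^sub>0 0 / q, coeff P\<^sub>0 1 / q:] * Q"
        using linear[of P\<^sub>0] degree_le assms(1) by simp
    qed (use False q in simp)
  next
    case True
    then have "coeff P\<^sub>1 1 \<noteq> 0"
      using no_common_zero_at_infinity degree_Q_less assms by (simp add: coeff_eq_0)
    show ?thesis
    proof (rule rectifiable_of_affine_combination[OF f Q_real_nonzero])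
      show "smult 0 P\<^sub>0 + smult 1 P\<^sub>1 = [:coeff P\<^sub>1 0 / q, coeff P\<^sub>1 1 / q:] * Q"
        using linear[of P\<^sub>1] degree_le assms(1) by simp
    qed (use \<open>coeff P\<^sub>1 1 \<noteq> 0\<close> q in simp)
  qed
qed

text \<open>The combination that cancels t^3 has this number as its coefficient of t^2. The same
  number multiplies \<sigma> once \<pi> is eliminated from the two double point equations; if it
  were nonzero, they would have a single solution, and a real one.\<close>

lemma no_polynomial_cubic:
  assumes e: "e = 3" and deg_Q: "degree Q = 0"
  shows "coeff P\<^sub>1 3 * coeff P\<^sub>0 2 - coeff P\<^sub>0 3 * coeff P\<^sub>1 2 = 0"
proof (rule ccontr)
  obtain q where Q: "Q = [:q:]" using deg_Q degree_0_id by metis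
  then have q: "q \<noteq> 0" using Q_nonzero by auto
  obtain a\<^sub>0 a\<^sub>1 a\<^sub>2 a\<^sub>3 where P\<^sub>0: "P\<^sub>0 = [:a\<^sub>0, a\<^sub>1, a\<^sub>2, a\<^sub>3:]"
    using degree_le_cubic degree_le(1) e by blast
  obtain b\<^sub>0 b\<^sub>1 b\<^sub>2 b\<^sub>3 where P\<^sub>1: "P\<^sub>1 = [:b\<^sub>0, b\<^sub>1, b\<^sub>2, b\<^sub>3:]"
    using degree_le_cubic degree_le(2) e by blast
  have top: "a\<^sub>3 \<noteq> 0 \<or> b\<^sub>3 \<noteq> 0"
    using no_common_zero_at_infinity degree_Q_less deg_Q
    by (simp add: e coeff_eq_0 P\<^sub>0 P\<^sub>1 numeral_eq_Suc)
  define A where "A = b\<^sub>3 * a\<^sub>2 - a\<^sub>3 * b\<^sub>2"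
  assume "coeff P\<^sub>1 3 * coeff P\<^sub>0 2 - coeff P\<^sub>0 3 * coeff P\<^sub>1 2 \<noteq> 0"
  then have A: "A \<noteq> 0" by (simp add: A_def P\<^sub>0 P\<^sub>1 numeral_eq_Suc)
  \<comment> \<open>\<sigma> solves the linear equation left after elimination; \<pi> is then read
    off from whichever equation has a nonzero cubic coefficient.\<close>
  define \<sigma> where "\<sigma> = - (b\<^sub>3 * a\<^sub>1 - a\<^sub>3 * b\<^sub>1) / A"
  define \<pi> where "\<pi> = \<sigma>\<^sup>2 + (if a\<^sub>3 \<noteq> 0 then (a\<^sub>2 * \<sigma> + a\<^sub>1) / a\<^sub>3 else (b\<^sub>2 * \<sigma> + b\<^sub>1) / b\<^sub>3)"
  \<comment> \<open>The difference quotient of a cubic polynomial, using s^2 + s t + t^2 = (s + t)^2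
    - s t. The factor \<open>q\<close> is the constant denominator.\<close>
  define E where "E = (\<lambda>(c\<^sub>1::real) c\<^sub>2 c\<^sub>3 (x::complex) y.
      of_real q * (of_real c\<^sub>3 * (x\<^sup>2 - y) + of_real c\<^sub>2 * x + of_real c\<^sub>1))"
  note ev = eval1_pCons[OF ring_map_of_real]
  have \<sigma>: "b\<^sub>3 * (a\<^sub>2 * \<sigma> + a\<^sub>1) = a\<^sub>3 * (b\<^sub>2 * \<sigma> + b\<^sub>1)"
  proof -
    have "A * \<sigma> = - (b\<^sub>3 * a\<^sub>1 - a\<^sub>3 * b\<^sub>1)" using A by (simp add: \<sigma>_def)
    then show ?thesis by (simp add: A_def algebra_simps)
  qed
  have zero: "a\<^sub>3 * (\<sigma>\<^sup>2 - \<pi>) + a\<^sub>2 * \<sigma> + a\<^sub>1 = 0" "b\<^sub>3 * (\<sigma>\<^sup>2 - \<pi>) + b\<^sub>2 * \<sigma> + b\<^sub>1 = 0"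
  proof (atomize (full), cases "a\<^sub>3 = 0")
    case True
    then have "b\<^sub>3 \<noteq> 0" "a\<^sub>2 * \<sigma> + a\<^sub>1 = 0" using top \<sigma> by auto
    then show "a\<^sub>3 * (\<sigma>\<^sup>2 - \<pi>) + a\<^sub>2 * \<sigma> + a\<^sub>1 = 0 \<and> b\<^sub>3 * (\<sigma>\<^sup>2 - \<pi>) + b\<^sub>2 * \<sigma> + b\<^sub>1 = 0"
      using True by (simp add: \<pi>_def)
  next
    case False
    then show "a\<^sub>3 * (\<sigma>\<^sup>2 - \<pi>) + a\<^sub>2 * \<sigma> + a\<^sub>1 = 0 \<and> b\<^sub>3 * (\<sigma>\<^sup>2 - \<pi>) + b\<^sub>2 * \<sigma> + b\<^sub>1 = 0"
      using \<sigma> by (simp add: \<pi>_def field_simps)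
  qed
  have E_real: "E c\<^sub>1 c\<^sub>2 c\<^sub>3 (of_real \<sigma>) (of_real \<pi>) = of_real (q * (c\<^sub>3 * (\<sigma>\<^sup>2 - \<pi>) + c\<^sub>2 * \<sigma> + c\<^sub>1))" for c\<^sub>1 c\<^sub>2 c\<^sub>3
    by (simp add: E_def)
  show False
  proof (rule no_unique_double_point[where E\<^sub>0 = "E a\<^sub>1 a\<^sub>2 a\<^sub>3" and E\<^sub>1 = "E b\<^sub>1 b\<^sub>2 b\<^sub>3" and \<sigma> = \<sigma> and \<pi> = \<pi>])
    show "E a\<^sub>1 a\<^sub>2 a\<^sub>3 (of_real \<sigma>) (of_real \<pi>) = 0" "E b\<^sub>1 b\<^sub>2 b\<^sub>3 (of_real \<sigma>) (of_real \<pi>) = 0"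
      unfolding E_real zero by simp_all
    show "s + t = of_real \<sigma>" if "E a\<^sub>1 a\<^sub>2 a\<^sub>3 (s + t) (s * t) = 0" "E b\<^sub>1 b\<^sub>2 b\<^sub>3 (s + t) (s * t) = 0" for s t
    proof -
      define x where "x = s + t"
      have "of_real a\<^sub>3 * (x\<^sup>2 - s * t) + of_real a\<^sub>2 * x + of_real a\<^sub>1 = 0"
        "of_real b\<^sub>3 * (x\<^sup>2 - s * t) + of_real b\<^sub>2 * x + of_real b\<^sub>1 = 0"
        using that q by (simp_all add: E_def x_def)
      then have "of_real b\<^sub>3 * (of_real a\<^sub>2 * x + of_real a\<^sub>1) - of_real a\<^sub>3 * (of_real b\<^sub>2 * x + of_real b\<^sub>1) = 0"
        by algebra
      then have "of_real A * x = of_real (- (b\<^sub>3 * a\<^sub>1 - a\<^sub>3 * b\<^sub>1))"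
        by (simp add: A_def algebra_simps)
      then have "x = of_real (- (b\<^sub>3 * a\<^sub>1 - a\<^sub>3 * b\<^sub>1)) / of_real A"
        using A by (metis nonzero_mult_div_cancel_left of_real_eq_0_iff)
      then show ?thesis by (simp add: x_def \<sigma>_def)
    qed
  qed (use q in \<open>simp_all add: E_def P\<^sub>0 P\<^sub>1 Q ev pderiv_pCons power2_eq_square algebra_simps\<close>)
qed

text \<open>For a nonzero determinant the double point equations express \<omega> and \<tau>
  linearly as u M and v M, where M = Q(s) Q(t) is in turn a quadratic form in \<omega> and \<tau>.
  This form has no nontrivial real zero, so M, and with it \<sigma> and \<pi>, is determined by real
  formulas.\<close>

lemma parallel_remainders:
  assumes P\<^sub>0: "P\<^sub>0 = [:k\<^sub>0, l\<^sub>0:] * Q + [:d\<^sub>0, c\<^sub>0:]" and P\<^sub>1: "P\<^sub>1 = [:k\<^sub>1, l\<^sub>1:] * Q + [:d\<^sub>1, c\<^sub>1:]"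
    and deg_Q: "degree Q = 2" and l: "l\<^sub>0 \<noteq> 0 \<or> l\<^sub>1 \<noteq> 0"
  shows "c\<^sub>0 * d\<^sub>1 - c\<^sub>1 * d\<^sub>0 = 0"
proof (rule ccontr)
  assume "c\<^sub>0 * d\<^sub>1 - c\<^sub>1 * d\<^sub>0 \<noteq> 0"
  define D where "D = c\<^sub>0 * d\<^sub>1 - c\<^sub>1 * d\<^sub>0"
  have D: "D \<noteq> 0" using \<open>_ \<noteq> 0\<close> by (simp add: D_def)
  obtain q\<^sub>0 q\<^sub>1 q\<^sub>2 where Q: "Q = [:q\<^sub>0, q\<^sub>1, q\<^sub>2:]"
    using degree_le_cubic[of Q] deg_Q by (auto simp: coeff_eq_0)
  have "coeff Q 2 \<noteq> 0"
    using leading_coeff_0_iff[of Q] Q_nonzero unfolding deg_Q by simp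
  then have q\<^sub>2: "q\<^sub>2 \<noteq> 0" by (simp add: Q numeral_eq_Suc)
  \<comment> \<open>This is the homogenization of \<open>Q\<close> at (-x, y), so it is nonzero
    because \<open>Q\<close> has no real zero.\<close>
  have definite: "q\<^sub>2 * x\<^sup>2 - q\<^sub>1 * x * y + q\<^sub>0 * y\<^sup>2 \<noteq> 0" if "x \<noteq> 0 \<or> y \<noteq> 0" for x y :: real
  proof (cases "y = 0")
    case True
    then show ?thesis using that q\<^sub>2 by simp
  next
    case False
    have "poly Q (- x / y) * y\<^sup>2 \<noteq> 0" using Q_real_nonzero False by simp
    also have "poly Q (- x / y) * y\<^sup>2 = q\<^sub>2 * x\<^sup>2 - q\<^sub>1 * x * y + q\<^sub>0 * y\<^sup>2"
      using False by (simp add: Q field_simps power2_eq_square)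
    finally show ?thesis .
  qed
  \<comment> \<open>Cramer's rule for the two double point equations with M scaled to 1.\<close>
  define u v where "u = (l\<^sub>1 * d\<^sub>0 - l\<^sub>0 * d\<^sub>1) / D" and "v = (l\<^sub>1 * c\<^sub>0 - l\<^sub>0 * c\<^sub>1) / D"
  have uv: "l\<^sub>0 + c\<^sub>0 * u - d\<^sub>0 * v = 0" "l\<^sub>1 + c\<^sub>1 * u - d\<^sub>1 * v = 0"
    using D unfolding u_def v_def by (simp_all add: field_simps) (simp_all add: D_def algebra_simps)
  define K where "K = q\<^sub>2 * u\<^sup>2 - q\<^sub>1 * u * v + q\<^sub>0 * v\<^sup>2"
  have "u \<noteq> 0 \<or> v \<noteq> 0" using uv l by auto
  then have K: "K \<noteq> 0" unfolding K_def by (rule definite)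
  \<comment> \<open>Inserting \<omega> = N u, \<tau> = N v and M = N into the quadratic relation
    gives q_2 N = N^2 K, hence this value.\<close>
  define N where "N = q\<^sub>2 / K"
  define \<sigma> \<pi> where "\<sigma> = (N * v - q\<^sub>1) / q\<^sub>2" and "\<pi> = (q\<^sub>0 - N * u) / q\<^sub>2"
  \<comment> \<open>\<omega> and -\<tau> are the difference quotients of t/Q and 1/Q, multiplied by
    Q(s) Q(t). \<open>M\<close> is the product Q(s) Q(t) itself, rewritten in terms of \<omega> and
    \<tau>.\<close>
  define \<omega> \<tau> M where "\<omega> = (\<lambda>y::complex. of_real q\<^sub>0 - of_real q\<^sub>2 * y)"
    and "\<tau> = (\<lambda>x::complex. of_real q\<^sub>2 * x + of_real q\<^sub>1)"
    and "M = (\<lambda>x y. (of_real q\<^sub>2 * (\<omega> y)\<^sup>2 - of_real q\<^sub>1 * \<omega> y * \<tau> x + of_real q\<^sub>0 * (\<tau> x)\<^sup>2) / of_real q\<^sub>2)"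
  define E where "E = (\<lambda>(l::real) (c::real) (d::real) x y.
      of_real l * M x y + of_real c * \<omega> y - of_real d * \<tau> x)"
  note ev = eval1_pCons[OF ring_map_of_real]
  define r where "r = (\<lambda>t::complex. of_real q\<^sub>2 * t\<^sup>2 + of_real q\<^sub>1 * t + of_real q\<^sub>0)"
  have ev_Q: "eval1 of_real Q = r"
    by (rule ext) (simp add: Q r_def ev power2_eq_square algebra_simps)
  have M: "M (s + t) (s * t) = r s * r t" for s t
    using q\<^sub>2 by (simp add: M_def \<omega>_def \<tau>_def r_def field_simps power2_eq_square)
  have \<omega>\<pi>: "\<omega> (of_real \<pi>) = of_real (N * u)" and \<tau>\<sigma>: "\<tau> (of_real \<sigma>) = of_real (N * v)"
    using q\<^sub>2 by (simp_all add: \<omega>_def \<tau>_def \<pi>_def \<sigma>_def)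
  have M_N: "M (of_real \<sigma>) (of_real \<pi>) = of_real N"
  proof -
    have "M (of_real \<sigma>) (of_real \<pi>) = of_real (N * (N * K) / q\<^sub>2)"
      unfolding M_def \<omega>\<pi> \<tau>\<sigma> K_def by (simp add: algebra_simps power2_eq_square)
    also have "N * K = q\<^sub>2" using K by (simp add: N_def)
    finally show ?thesis using q\<^sub>2 by simp
  qed
  have N: "N \<noteq> 0" using q\<^sub>2 K by (simp add: N_def)
  have diff: "eval1 of_real P s * eval1 of_real Q t - eval1 of_real P t * eval1 of_real Q s
      = (s - t) * E l c d (s + t) (s * t)" if P: "P = [:k, l:] * Q + [:d, c:]" for P k l c d s t
  proof -
    have "eval1 of_real P z = (of_real k + of_real l * z) * r z + (of_real d + of_real c * z)" for z
      unfolding P by (simp only: eval1_mult[OF ring_map_of_real] ring_map.add[OF ring_map_eval1[OF ring_map_of_real]] ev_Q)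
        (simp add: ev algebra_simps)
    then show ?thesis
      unfolding E_def M ev_Q by (simp add: r_def \<omega>_def \<tau>_def algebra_simps power2_eq_square)
  qed
  have deriv: "complex_of_real (poly (pderiv P) t * poly Q t - poly P t * poly (pderiv Q) t)
      = E l c d (of_real (2 * t)) (of_real (t * t))" if P: "P = [:k, l:] * Q + [:d, c:]" for P k l c d t
  proof -
    define z where "z = complex_of_real t"
    have Mz: "M (2 * z) (z * z) = r z * r z" using M[of z z] by simp
    have "poly (pderiv P) t * poly Q t - poly P t * poly (pderiv Q) t =
        l * (poly Q t * poly Q t) + c * poly Q t - (d + c * t) * poly (pderiv Q) t"
      unfolding P by (simp add: pderiv_add pderiv_mult pderiv_smult pderiv_pCons algebra_simps)
    also have "of_real \<dots> = of_real l * (r z * r z) + of_real c * \<omega> (z * z) - of_real d * \<tau> (2 * z)"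
      by (simp add: Q pderiv_pCons r_def z_def \<omega>_def \<tau>_def algebra_simps power2_eq_square)
    also have "\<dots> = E l c d (2 * z) (z * z)"
      unfolding E_def Mz by simp
    finally show ?thesis by (simp add: z_def)
  qed
  have E_zero: "E l c d (of_real \<sigma>) (of_real \<pi>) = 0" if "l + c * u - d * v = 0" for l c d
  proof -
    have "E l c d (of_real \<sigma>) (of_real \<pi>) = of_real (N * (l + c * u - d * v))"
      unfolding E_def M_N \<omega>\<pi> \<tau>\<sigma> by (simp add: algebra_simps)
    then show ?thesis using that by simp
  qed
  show False
  proof (rule no_unique_double_point[OF diff[OF P\<^sub>0] diff[OF P\<^sub>1] deriv[OF P\<^sub>0] deriv[OF P\<^sub>1]
        E_zero[OF uv(1)] E_zero[OF uv(2)]])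
    show "eval1 complex_of_real Q s \<noteq> 0" if "s + t = of_real \<sigma>" "s * t = of_real \<pi>" for s t
      using M[of s t] M_N N that unfolding ev_Q by auto
    show "s + t = of_real \<sigma>"
      if nz: "eval1 complex_of_real Q s \<noteq> 0" "eval1 complex_of_real Q t \<noteq> 0"
        and E: "E l\<^sub>0 c\<^sub>0 d\<^sub>0 (s + t) (s * t) = 0" "E l\<^sub>1 c\<^sub>1 d\<^sub>1 (s + t) (s * t) = 0" for s t
    proof -
      define m w z where "m = M (s + t) (s * t)" and "w = \<omega> (s * t)" and "z = \<tau> (s + t)"
      have m: "m \<noteq> 0" using nz by (simp add: m_def M ev_Q)
      have eqs: "of_real l\<^sub>0 * m + of_real c\<^sub>0 * w - of_real d\<^sub>0 * z = 0"
        "of_real l\<^sub>1 * m + of_real c\<^sub>1 * w - of_real d\<^sub>1 * z = 0"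
        using E by (simp_all add: E_def m_def w_def z_def)
      have "(of_real c\<^sub>0 * of_real d\<^sub>1 - of_real c\<^sub>1 * of_real d\<^sub>0) * w = m * (of_real l\<^sub>1 * of_real d\<^sub>0 - of_real l\<^sub>0 * of_real d\<^sub>1)"
        "(of_real c\<^sub>0 * of_real d\<^sub>1 - of_real c\<^sub>1 * of_real d\<^sub>0) * z = m * (of_real l\<^sub>1 * of_real c\<^sub>0 - of_real l\<^sub>0 * of_real c\<^sub>1)"
        using eqs by algebra+
      then have "of_real D * w = m * of_real (l\<^sub>1 * d\<^sub>0 - l\<^sub>0 * d\<^sub>1)" "of_real D * z = m * of_real (l\<^sub>1 * c\<^sub>0 - l\<^sub>0 * c\<^sub>1)"
        by (simp_all add: D_def)
      then have wz: "w = m * of_real u" "z = m * of_real v"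
        using D by (simp_all add: u_def v_def field_simps)
      have "of_real q\<^sub>2 * m = of_real q\<^sub>2 * w\<^sup>2 - of_real q\<^sub>1 * w * z + of_real q\<^sub>0 * z\<^sup>2"
        using q\<^sub>2 by (simp add: m_def M_def w_def z_def)
      also have "\<dots> = m * (m * of_real K)"
        unfolding wz K_def by (simp add: algebra_simps power2_eq_square)
      finally have "of_real q\<^sub>2 = m * of_real K" using m by simp
      then have "m = of_real N" using K by (simp add: N_def)
      then have "of_real q\<^sub>2 * (s + t) = of_real (N * v - q\<^sub>1)"
        using wz(2) by (simp add: z_def \<tau>_def algebra_simps)
      then show ?thesis using q\<^sub>2 by (simp add: \<sigma>_def field_simps)
    qed
  qed
qed

lemma rectifiable_of_degree_le_3:
  assumes e: "e \<le> 3"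
  shows "rectifiable f"
proof -
  have not_1: "degree Q \<noteq> 1"
  proof
    assume deg: "degree Q = 1"
    then have "coeff Q 1 \<noteq> 0" using leading_coeff_0_iff[of Q] by auto
    moreover have "Q = [:coeff Q 0, coeff Q 1:]"
      using degree_le_cubic[of Q] deg by (simp add: coeff_eq_0)
    ultimately have "poly Q (- coeff Q 0 / coeff Q 1) = 0"
      by (metis (no_types) add.right_inverse mult_zero_right add_0_right nonzero_mult_div_cancel_right
          poly_pCons poly_0 divide_minus_left mult_minus_left times_divide_eq_left)
    then show False using Q_real_nonzero by blast
  qed
  consider "e = 1" "degree Q = 0" | "e = 2" "degree Q = 0" | "e = 3" "degree Q = 0" | "e = 3" "degree Q = 2"
    using degree_Q_less not_1 e by linarith
  then show ?thesis
  proof cases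
    case 1
    then show ?thesis by (rule rectifiable_polynomial_degree_1)
  next
    case 2
    then obtain q where Q: "Q = [:q:]" using degree_0_id by metis
    then have q: "q \<noteq> 0" using Q_nonzero by auto
    define p where "p = smult (coeff P\<^sub>1 2) P\<^sub>0 + smult (- coeff P\<^sub>0 2) P\<^sub>1"
    have "degree p \<le> 2"
      unfolding p_def using degree_le 2 by (intro degree_add_le order_trans[OF degree_smult_le]) simp_all
    moreover have "coeff p 2 = 0" by (simp add: p_def)
    ultimately have p: "p = [:coeff p 0 / q, coeff p 1 / q:] * Q"
      using degree_le_cubic[of p] q by (simp add: Q coeff_eq_0)
    have "coeff P\<^sub>1 2 \<noteq> 0 \<or> - coeff P\<^sub>0 2 \<noteq> 0"
      using no_common_zero_at_infinity 2 by (auto simp: coeff_eq_0)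
    from rectifiable_of_linear_combination[OF _ this p[unfolded p_def]] show ?thesis
      using 2 by simp
  next
    case 3
    then obtain q where Q: "Q = [:q:]" using degree_0_id by metis
    then have q: "q \<noteq> 0" using Q_nonzero by auto
    define p where "p = smult (coeff P\<^sub>1 3) P\<^sub>0 + smult (- coeff P\<^sub>0 3) P\<^sub>1"
    have "degree p \<le> 3"
      unfolding p_def using degree_le 3 by (intro degree_add_le order_trans[OF degree_smult_le]) simp_all
    moreover have "coeff p 3 = 0" by (simp add: p_def)
    moreover have "coeff p 2 = 0" using no_polynomial_cubic 3 by (simp add: p_def)
    ultimately have p: "p = [:coeff p 0 / q, coeff p 1 / q:] * Q"
      using degree_le_cubic[of p] q by (simp add: Q)
    have "coeff P\<^sub>1 3 \<noteq> 0 \<or> - coeff P\<^sub>0 3 \<noteq> 0"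
      using no_common_zero_at_infinity 3 by (auto simp: coeff_eq_0)
    from rectifiable_of_linear_combination[OF _ this p[unfolded p_def]] show ?thesis
      using 3 by simp
  next
    case 4
    \<comment> \<open>Only the remainder modulo \<open>Q\<close> obstructs an affine combination.
      The cubic coefficients pass to the slopes of the quotients, which therefore cannot both
      vanish.\<close>
    have division: "\<exists>k l d c. P = [:k, l:] * Q + [:d, c:] \<and> coeff P 3 = l * coeff Q 2" if "degree P \<le> 3" for P
    proof -
      have "degree (P div Q) \<le> 1"
      proof (cases "P div Q = 0")
        case False
        have "degree (P mod Q) \<le> 3"
          using degree_mod_less[OF Q_nonzero, of P] 4 by auto
        then have "degree (P - P mod Q) \<le> 3" using that by (intro degree_diff_le)
        also have "P - P mod Q = P div Q * Q" by (simp add: minus_mod_eq_div_mult)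
        finally show ?thesis using degree_mult_eq[OF False Q_nonzero] 4 by simp
      qed simp
      moreover have "degree (P mod Q) \<le> 1"
        using degree_mod_less[OF Q_nonzero, of P] 4 by auto
      ultimately have kl: "P div Q = [:coeff (P div Q) 0, coeff (P div Q) 1:]"
          and dc: "P mod Q = [:coeff (P mod Q) 0, coeff (P mod Q) 1:]"
        using degree_le_cubic[of "P div Q"] degree_le_cubic[of "P mod Q"] by (simp_all add: coeff_eq_0)
      have P: "P = [:coeff (P div Q) 0, coeff (P div Q) 1:] * Q + [:coeff (P mod Q) 0, coeff (P mod Q) 1:]"
        unfolding kl[symmetric] dc[symmetric] by simp
      have "coeff ([:k, l:] * Q + [:d, c:]) 3 = l * coeff Q 2" for k l d c
        using 4 by (simp add: coeff_eq_0 numeral_eq_Suc coeff_pCons)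
      then show ?thesis using P by metis
    qed
    obtain k\<^sub>0 l\<^sub>0 d\<^sub>0 c\<^sub>0 where P\<^sub>0: "P\<^sub>0 = [:k\<^sub>0, l\<^sub>0:] * Q + [:d\<^sub>0, c\<^sub>0:]" "coeff P\<^sub>0 3 = l\<^sub>0 * coeff Q 2"
      using division degree_le(1) 4 by blast
    obtain k\<^sub>1 l\<^sub>1 d\<^sub>1 c\<^sub>1 where P\<^sub>1: "P\<^sub>1 = [:k\<^sub>1, l\<^sub>1:] * Q + [:d\<^sub>1, c\<^sub>1:]" "coeff P\<^sub>1 3 = l\<^sub>1 * coeff Q 2"
      using division degree_le(2) 4 by blast
    have "l\<^sub>0 \<noteq> 0 \<or> l\<^sub>1 \<noteq> 0"
      using no_common_zero_at_infinity 4 P\<^sub>0(2) P\<^sub>1(2) by (auto simp: coeff_eq_0)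
    then have D: "c\<^sub>0 * d\<^sub>1 - c\<^sub>1 * d\<^sub>0 = 0"
      by (rule parallel_remainders[OF P\<^sub>0(1) P\<^sub>1(1) 4(2)])
    \<comment> \<open>A homogeneous system with determinant 0 has a nontrivial solution: any nonzero
      row of coefficients, swapped with one sign changed, solves both equations.\<close>
    have "\<exists>m n. (m \<noteq> 0 \<or> n \<noteq> 0) \<and> m * c\<^sub>0 + n * c\<^sub>1 = 0 \<and> m * d\<^sub>0 + n * d\<^sub>1 = 0"
    proof -
      consider "c\<^sub>0 \<noteq> 0 \<or> c\<^sub>1 \<noteq> 0" | "d\<^sub>0 \<noteq> 0 \<or> d\<^sub>1 \<noteq> 0" | "c\<^sub>0 = 0" "c\<^sub>1 = 0" "d\<^sub>0 = 0" "d\<^sub>1 = 0"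
        by blast
      then show ?thesis
      proof cases
        case 1
        then show ?thesis using D by (intro exI[of _ c\<^sub>1] exI[of _ "- c\<^sub>0"]) (auto simp: algebra_simps)
      next
        case 2
        then show ?thesis using D by (intro exI[of _ d\<^sub>1] exI[of _ "- d\<^sub>0"]) (auto simp: algebra_simps)
      next
        case 3
        then show ?thesis by (intro exI[of _ 1]) simp
      qed
    qed
    then obtain m n where mn: "m \<noteq> 0 \<or> n \<noteq> 0" "m * c\<^sub>0 + n * c\<^sub>1 = 0" "m * d\<^sub>0 + n * d\<^sub>1 = 0"
      by blast
    have "smult m P\<^sub>0 + smult n P\<^sub>1 =
        [:m * k\<^sub>0 + n * k\<^sub>1, m * l\<^sub>0 + n * l\<^sub>1:] * Q + [:m * d\<^sub>0 + n * d\<^sub>1, m * c\<^sub>0 + n * c\<^sub>1:]"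
      unfolding P\<^sub>0(1) P\<^sub>1(1) by (simp add: algebra_simps smult_add_right smult_add_left)
    then show ?thesis
      using mn 4 by (intro rectifiable_of_linear_combination[of m n]) simp_all
  qed
qed

end

section \<open>Dehomogenization\<close>

lemma eval2_dehomogenize:
  assumes "ring_map h"
  shows "eval2 h F (a, 1) = eval1 h (poly F 1) a"
  using eval_natural[OF ring_map_id ring_map_eval1[OF assms, of a], of F 1]
  by (simp add: eval2_def eval1_1[OF assms])

lemma coeff_poly_1: "coeff (poly F 1) i = (\<Sum>j\<le>degree F. coeff (coeff F j) i)"
  by (simp add: poly_altdef coeff_sum)

lemma form2_degree_dehomogenize:
  assumes "form2 e F"
  shows "degree (poly F 1) \<le> e"
proof (rule degree_le, intro allI impI)
  fix i assume "e < i"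
  then have "coeff (coeff F j) i = 0" for j
    using assms unfolding form2_def by fastforce
  then show "coeff (poly F 1) i = 0" by (simp add: coeff_poly_1)
qed

text \<open>Only the monomial u^e survives at v = 0, and it is also the only one that becomes t^e at
  v = 1.\<close>

lemma form2_at_infinity:
  assumes "form2 e F"
  shows "eval2 complex_of_real F (1, 0) = of_real (coeff (poly F 1) e)"
proof -
  have "coeff (coeff F j) e = 0" if "j \<noteq> 0" for j
    using assms that unfolding form2_def by fastforce
  then have "coeff (poly F 1) e = (\<Sum>j\<in>{0}. coeff (coeff F j) e)"
    unfolding coeff_poly_1 by (intro sum.mono_neutral_right) auto
  moreover have "coeff F 0 = monom (coeff (coeff F 0) e) e"
  proof (rule poly_eqI)
    fix i show "coeff (coeff F 0) i = coeff (monom (coeff (coeff F 0) e) e) i"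
      using assms unfolding form2_def by (cases "i = e") fastforce+
  qed
  then have "eval1 complex_of_real (coeff F 0) 1 = of_real (coeff (coeff F 0) e)"
    by (metis eval1_def map_poly_monom of_real_0 poly_monom power_one mult.right_neutral)
  ultimately show ?thesis
    by (simp add: eval2_def poly_0_coeff_0 coeff_map_poly)
qed

text \<open>The exponent of Z is determined by the other two, so setting Z = 1 merges no monomials.
  This yields both the degree bound and the nonvanishing of the affine equation.\<close>

lemma form3_coeff_dehomogenize:
  assumes "form3 d G"
  shows "coeff (coeff (poly G 1) j) i = (if i + j \<le> d then coeff (coeff (coeff G (d - i - j)) j) i else 0)"
proof -
  have sum: "coeff (coeff (poly G 1) j) i = (\<Sum>k\<le>degree G. coeff (coeff (coeff G k) j) i)"
    by (simp add: poly_altdef coeff_sum)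
  have zero: "coeff (coeff (coeff G k) j) i = 0" if "i + j + k \<noteq> d" for k
    using assms that unfolding form3_def by blast
  show ?thesis
  proof (cases "i + j \<le> d \<and> d - i - j \<le> degree G")
    case True
    then have "(\<Sum>k\<le>degree G. coeff (coeff (coeff G k) j) i)
        = (\<Sum>k\<in>{d - i - j}. coeff (coeff (coeff G k) j) i)"
      by (intro sum.mono_neutral_right) (auto intro!: zero)
    then show ?thesis using True sum by simp
  next
    case False
    then have "(\<Sum>k\<le>degree G. coeff (coeff (coeff G k) j) i) = 0"
      by (intro sum.neutral ballI zero) auto
    then show ?thesis using False sum by (auto simp: coeff_eq_0)
  qed
qed

text \<open>Every monomial contributes the factor q^d. With \<open>q\<close> the common denominator
  of the coordinates, a relation among the three forms becomes an affine equation of the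
  image.\<close>

lemma form3_eval_homogeneous:
  assumes h: "ring_map h" and G: "form3 d G"
  shows "eval3 h G (q * x, q * y, q) = q ^ d * eval2 h (poly G 1) (x, y)"
proof -
  have "degree G \<le> d"
  proof (rule degree_le, intro allI impI)
    fix k assume "d < k"
    then have "coeff (coeff (coeff G k) j) i = 0" for i j
      using G unfolding form3_def by fastforce
    then show "coeff G k = 0" by (simp add: poly_eq_iff)
  qed
  have le: "i + j \<le> d" if "coeff (coeff (coeff G k) j) i \<noteq> 0" for i j k
    using G that unfolding form3_def by fastforce
  have alt: "eval2 h (coeff G k) z =
      (\<Sum>j\<le>d. \<Sum>i\<le>d. h (coeff (coeff (coeff G k) j) i) * fst z ^ i * snd z ^ j)" for k z
    by (rule eval2_altdef[OF h]) (rule le)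
  have "eval2 h (coeff G k) (q * x, q * y) * q ^ k = q ^ d * eval2 h (coeff G k) (x, y)" for k
    unfolding alt sum_distrib_left sum_distrib_right
  proof (intro sum.cong refl)
    fix i j
    show "h (coeff (coeff (coeff G k) j) i) * fst (q * x, q * y) ^ i * snd (q * x, q * y) ^ j * q ^ k =
        q ^ d * (h (coeff (coeff (coeff G k) j) i) * fst (x, y) ^ i * snd (x, y) ^ j)"
    proof (cases "coeff (coeff (coeff G k) j) i = 0")
      case False
      then have "d = i + j + k" using G unfolding form3_def by simp
      then show ?thesis by (simp add: power_add power_mult_distrib mult_ac)
    qed (simp add: ring_map.zero[OF h])
  qed
  then have "eval3 h G (q * x, q * y, q) = q ^ d * (\<Sum>k\<le>d. eval2 h (coeff G k) (x, y))"
    using \<open>degree G \<le> d\<close>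
    by (simp add: eval3_def ring_map.eval_altdef[OF ring_map_eval2[OF h]] sum_distrib_left)
  also have "(\<Sum>k\<le>d. eval2 h (coeff G k) (x, y)) = eval2 h (poly G 1) (x, y)"
  proof -
    have "poly G 1 = (\<Sum>k\<le>d. coeff G k)"
      using ring_map.eval_altdef[OF ring_map_id \<open>degree G \<le> d\<close>, of 1] by simp
    then show ?thesis by (simp add: ring_map.sum[OF ring_map_eval2[OF h]])
  qed
  finally show ?thesis .
qed

theorem proposition31:
  fixes f :: "real poly fract \<times> real poly fract" and d :: nat
  assumes "rational_smooth_embedding f"
    and "has_degree (associated_curve f) d"
    and "d \<le> 3"
  shows "rectifiable f"
proof -
  obtain G where G: "G \<noteq> 0" "form3 d G" "associated_curve f = {H. G dvd H}"
    using assms(2) unfolding has_degree_def by blast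
  \<comment> \<open>The generator lies in its own ideal, and membership supplies an extension of
    \<open>f\<close> on which it vanishes; that extension provides the parametrization.\<close>
  then have "G \<in> associated_curve f" by simp
  then obtain F\<^sub>0 F\<^sub>1 F\<^sub>2 where F: "extends_to f (F\<^sub>0, F\<^sub>1, F\<^sub>2)"
    and GF: "eval3 (\<lambda>c. [:[:c:]:]) G (F\<^sub>0, F\<^sub>1, F\<^sub>2) = 0"
    unfolding associated_curve_def by auto
  obtain e where forms: "form2 e F\<^sub>0" "form2 e F\<^sub>1" "form2 e F\<^sub>2"
    and base_point_free: "\<And>z. z \<noteq> (0, 0) \<Longrightarrow> eval2 complex_of_real F\<^sub>0 z \<noteq> 0 \<or>
        eval2 complex_of_real F\<^sub>1 z \<noteq> 0 \<or> eval2 complex_of_real F\<^sub>2 z \<noteq> 0"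
    using F unfolding extends_to_def projective_morphism_def by auto
  define P\<^sub>0 P\<^sub>1 Q where "P\<^sub>0 = poly F\<^sub>0 1" and "P\<^sub>1 = poly F\<^sub>1 1" and "Q = poly F\<^sub>2 1"
  have eval_F: "eval2 const1 F (var_t, 1) = Fract (poly F 1) 1" for F
    by (simp add: eval2_dehomogenize[OF ring_map_const1] eval1_const1_var)
  have Q: "Q \<noteq> 0" and f: "f = (Fract P\<^sub>0 1 / Fract Q 1, Fract P\<^sub>1 1 / Fract Q 1)"
    using F unfolding extends_to_def by (auto simp: eval_F P\<^sub>0_def P\<^sub>1_def Q_def Zero_fract_def)
  interpret parametrized_embedding f P\<^sub>0 P\<^sub>1 Q e
  proof
    show "f = (Fract P\<^sub>0 Q, Fract P\<^sub>1 Q)" using f Q by simp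
    show "coeff P\<^sub>0 e \<noteq> 0 \<or> coeff P\<^sub>1 e \<noteq> 0 \<or> coeff Q e \<noteq> 0"
      using base_point_free[of "(1, 0)"]
      by (simp add: form2_at_infinity[OF forms(1)] form2_at_infinity[OF forms(2)]
          form2_at_infinity[OF forms(3)] P\<^sub>0_def P\<^sub>1_def Q_def)
    show "eval1 complex_of_real P\<^sub>0 t \<noteq> 0 \<or> eval1 complex_of_real P\<^sub>1 t \<noteq> 0 \<or>
        eval1 complex_of_real Q t \<noteq> 0" for t
      using base_point_free[of "(t, 1)"]
      by (simp add: eval2_dehomogenize ring_map_of_real P\<^sub>0_def P\<^sub>1_def Q_def)
  qed (use Q assms(1) forms in \<open>simp_all add: form2_degree_dehomogenize P\<^sub>0_def P\<^sub>1_def Q_def\<close>)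
  have "e \<le> d"
  proof (rule parametrization_degree_le)
    show "i + j \<le> d" if "coeff (coeff (poly G 1) j) i \<noteq> 0" for i j
      using that by (simp add: form3_coeff_dehomogenize[OF G(2)] split: if_splits)
    show "poly G 1 \<noteq> 0"
    proof
      assume zero: "poly G 1 = 0"
      have "coeff (coeff (coeff G k) j) i = 0" for i j k
      proof (cases "i + j + k = d")
        case True
        then show ?thesis using form3_coeff_dehomogenize[OF G(2), of j i] zero by auto
      next
        case False
        then show ?thesis using G(2) unfolding form3_def by blast
      qed
      then have "G = 0" by (simp add: poly_eq_iff)
      then show False using G(1) by simp
    qed
    note h = ring_map_const1
    define x y q where "x = fst f" and "y = snd f" and "q = Fract Q 1"
    have q: "q \<noteq> 0" using Q by (simp add: q_def Zero_fract_def eq_fract)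
    \<comment> \<open>The relation among the forms is specialized to (u, v) = (t, 1).\<close>
    have "eval3 const1 G (Fract P\<^sub>0 1, Fract P\<^sub>1 1, q) = 0"
      using eval3_natural[OF ring_map_const_poly2 ring_map_eval2[OF h, of "(var_t, 1)"], of G F\<^sub>0 F\<^sub>1 F\<^sub>2]
      by (simp add: GF eval_F P\<^sub>0_def P\<^sub>1_def Q_def q_def) (simp add: const1_def[abs_def])
    moreover have "Fract P\<^sub>0 1 = q * x" "Fract P\<^sub>1 1 = q * y"
      by (simp_all add: x_def y_def local.f q_def eq_fract Q)
    ultimately have "q ^ d * eval2 const1 (poly G 1) (x, y) = 0"
      by (simp add: form3_eval_homogeneous[OF h G(2)])
    then show "poly G 1 \<in> image_ideal f"
      using q by (simp add: image_ideal_def x_def y_def)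
  qed
  then show ?thesis
    using assms(3) by (intro rectifiable_of_degree_le_3) simp
qed

end
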